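(* Consider a global $C^1$ solution $(f^\alpha, E_1,E_2,B)$, $t\ge 0$, of the one-dimensional (one space, two momentum variables) relativistic Vlasov-Maxwell system with initial data as described in the context. (i) In the neutral case there is a constant $C$ (independent of $t,x$) such that $$C \ge \int_0^t \Big[E_1^2+(E_2-B)^2+\int \sum_\alpha f^\alpha\big(\sqrt{(m^\alpha)^2+|v|^2}-v_1\big)\,dv\Big]\Big|_{(\tau,\,x-t+\tau)}\,d\tau+\int_0^t \Big[E_1^2+(E_2+B)^2+\int \sum_\alpha f^\alpha\big(\sqrt{(m^\alpha)^2+|v|^2}+v_1\big)\,dv\Big]\Big|_{(\tau,\,x+t-\tau)}\,d\tau$$ for all $t\ge 0$ and $x\in\mathbb{R}$. (ii) In the monocharge case there is a constant $C$ (independent of $t,x$) such that, for all $t\ge 0$, $$C(C_0+t-x)\ge \int_0^t\Big[(E_2-B)^2+\int f\,\frac{(\sqrt{1+|v|^2}-v_1)^2}{\sqrt{1+|v|^2}}\,dv\Big]\Big|_{(\tau,\,x-t+\tau)}\,d\tau\quad\text{for } x<C_0+t,$$ and $$C(C_0+t+x)\ge \int_0^t\Big[(E_2+B)^2+\int f\,\frac{(\sqrt{1+|v|^2}+v_1)^2}{\sqrt{1+|v|^2}}\,dv\Big]\Big|_{(\tau,\,x+t-\tau)}\,d\tau\quad\text{for } -C_0-t<x.$$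
   Context: The system, for $\alpha=1,\dots,N$, $t\ge0$, $x\in\mathbb{R}$, $v=(v_1,v_2)\in\mathbb{R}^2$, is $$\partial_t f^\alpha+\hat v_1^\alpha\partial_x f^\alpha+e^\alpha(E_1+\hat v_2^\alpha B)\partial_{v_1}f^\alpha+e^\alpha(E_2-\hat v_1^\alpha B)\partial_{v_2}f^\alpha=0,$$ $$\rho(t,x)=\int\sum_\alpha e^\alpha f^\alpha(t,x,v)\,dv,\qquad j(t,x)=\int\sum_\alpha e^\alpha f^\alpha(t,x,v)\hat v^\alpha\,dv,$$ $$E_1(t,x)=\tfrac12\int_{-\infty}^x\rho(t,y)\,dy-\tfrac12\int_x^\infty\rho(t,y)\,dy,\qquad \partial_tE_2+\partial_xB=-j_2,\qquad \partial_tB+\partial_xE_2=0,$$ where $\hat v^\alpha=v/\sqrt{(m^\alpha)^2+|v|^2}$, $m^\alpha>0$ is the mass and $e^\alpha\in\mathbb{R}$ the charge of species $\alpha$; $v$-integrals are over $\mathbb{R}^2$. Initial data: $f^\alpha(0,x,v)=f_0^\alpha(x,v)\ge0$, $E_2(0,x)=E_{20}(x)$, $B(0,x)=B_0(x)$, where $f_0^\alpha\in C_0^1(\mathbb{R}^3)$ is nonnegative and compactly supported and $E_{20},B_0\in C^1_0(\mathbb{R})$ are compactly supported. $C_0>0$ is chosen so that $f_0^\alpha$ (for all $\alpha$), $E_{20}$ and $B_0$ vanish if $|x|\ge C_0$. The neutral case means $\iint\sum_\alpha e^\alpha f_0^\alpha\,dv\,dx=0$. The monocharge case means $N=1$, $e^1=1$,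 $m^1=1$, and then one writes $f=f^1$. Constants $C$ may depend on the initial data (and the fixed parameters of the system) but not on $t,x,v$. The notation $[\cdots]|_{(\tau,y)}$ means the quantity is evaluated at time $\tau$ and position $y$. *)

theory Defs
  imports "HOL-Analysis.Analysis"
begin

text \<open>
  Continuous differentiability on a set, derivatives being taken within the set. On
  \<open>{0..} \<times> UNIV\<close> this means \<open>C\<^sup>1\<close> up to the boundary \<open>t = 0\<close>, with one-sided time derivatives there.
\<close>
definition C1_on :: "'a::real_normed_vector set \<Rightarrow> ('a \<Rightarrow> real) \<Rightarrow> bool" where
  "C1_on S g \<longleftrightarrow> (\<exists>g' :: 'a \<Rightarrow> 'a \<Rightarrow>\<^sub>L real.
     (\<forall>z\<in>S. (g has_derivative blinfun_apply (g' z)) (at z within S)) \<and> continuous_on S g')"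

definition compactly_supported :: "('a::topological_space \<Rightarrow> real) \<Rightarrow> bool" where
  "compactly_supported g \<longleftrightarrow> compact (closure {z. g z \<noteq> 0})"

definition time_deriv :: "(real \<Rightarrow> real) \<Rightarrow> real \<Rightarrow> real" where
  "time_deriv g t = vector_derivative g (at t within {0..})"

definition vhat :: "real \<Rightarrow> real \<times> real \<Rightarrow> real \<times> real" where
  "vhat \<mu> v = v /\<^sub>R sqrt (\<mu>\<^sup>2 + (norm v)\<^sup>2)"

text \<open>
  Species are the indices \<open>\<alpha> \<in> {1..N}\<close>, with charges \<open>e \<alpha>\<close> and masses \<open>m \<alpha>\<close>; densities have the
  argument order \<open>f \<alpha> t x v\<close>.
\<close>
definition charge_density ::
  "nat \<Rightarrow> (nat \<Rightarrow> real) \<Rightarrow> (nat \<Rightarrow> real \<Rightarrow> real \<Rightarrow> real \<times> real \<Rightarrow> real) \<Rightarrow> real \<Rightarrow> real \<Rightarrow> real" where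
  "charge_density N e f t x = (LINT v|lborel. (\<Sum>\<alpha>=1..N. e \<alpha> * f \<alpha> t x v))"

definition current_density ::
  "nat \<Rightarrow> (nat \<Rightarrow> real) \<Rightarrow> (nat \<Rightarrow> real) \<Rightarrow> (nat \<Rightarrow> real \<Rightarrow> real \<Rightarrow> real \<times> real \<Rightarrow> real)
     \<Rightarrow> real \<Rightarrow> real \<Rightarrow> real \<times> real" where
  "current_density N e m f t x =
     (LINT v|lborel. (\<Sum>\<alpha>=1..N. (e \<alpha> * f \<alpha> t x v) *\<^sub>R vhat (m \<alpha>) v))"

definition admissible_data ::
  "nat \<Rightarrow> (nat \<Rightarrow> real \<Rightarrow> real \<times> real \<Rightarrow> real) \<Rightarrow> (real \<Rightarrow> real) \<Rightarrow> (real \<Rightarrow> real) \<Rightarrow> bool" where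
  "admissible_data N f0 E20 B0 \<longleftrightarrow>
     (\<forall>\<alpha>\<in>{1..N}. C1_on UNIV (\<lambda>(x, v). f0 \<alpha> x v) \<and>
        compactly_supported (\<lambda>(x, v). f0 \<alpha> x v) \<and> (\<forall>x v. 0 \<le> f0 \<alpha> x v)) \<and>
     C1_on UNIV E20 \<and> compactly_supported E20 \<and>
     C1_on UNIV B0 \<and> compactly_supported B0"

definition data_vanish_outside ::
  "nat \<Rightarrow> (nat \<Rightarrow> real \<Rightarrow> real \<times> real \<Rightarrow> real) \<Rightarrow> (real \<Rightarrow> real) \<Rightarrow> (real \<Rightarrow> real) \<Rightarrow> real \<Rightarrow> bool" where
  "data_vanish_outside N f0 E20 B0 C0 \<longleftrightarrow>
     (\<forall>x. C0 \<le> \<bar>x\<bar> \<longrightarrow> (\<forall>\<alpha>\<in>{1..N}. \<forall>v. f0 \<alpha> x v = 0) \<and> E20 x = 0 \<and> B0 x = 0)"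

text \<open>
  Nonnegativity of \<open>f \<alpha>\<close> and integrability of the integrands in \<open>\<rho>\<close>, \<open>j\<close> and \<open>E\<^sub>1\<close> are not
  required: the fields are continuous and the transport speed in \<open>x\<close> is less than 1, so each
  \<open>f \<alpha>\<close> is nonnegative and is compactly supported in \<open>(x, v)\<close>, uniformly for bounded \<open>t\<close>.
\<close>
definition global_C1_solution ::
  "nat \<Rightarrow> (nat \<Rightarrow> real) \<Rightarrow> (nat \<Rightarrow> real) \<Rightarrow>
   (nat \<Rightarrow> real \<Rightarrow> real \<times> real \<Rightarrow> real) \<Rightarrow> (real \<Rightarrow> real) \<Rightarrow> (real \<Rightarrow> real) \<Rightarrow>
   (nat \<Rightarrow> real \<Rightarrow> real \<Rightarrow> real \<times> real \<Rightarrow> real) \<Rightarrow>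
   (real \<Rightarrow> real \<Rightarrow> real) \<Rightarrow> (real \<Rightarrow> real \<Rightarrow> real) \<Rightarrow> (real \<Rightarrow> real \<Rightarrow> real) \<Rightarrow> bool" where
  "global_C1_solution N e m f0 E20 B0 f E1 E2 B \<longleftrightarrow>
     (\<forall>\<alpha>\<in>{1..N}. C1_on ({0..} \<times> UNIV) (\<lambda>(t, x, v). f \<alpha> t x v)) \<and>
     C1_on ({0..} \<times> UNIV) (\<lambda>(t, x). E1 t x) \<and>
     C1_on ({0..} \<times> UNIV) (\<lambda>(t, x). E2 t x) \<and>
     C1_on ({0..} \<times> UNIV) (\<lambda>(t, x). B t x) \<and>
     (\<forall>\<alpha>\<in>{1..N}. \<forall>t\<ge>0. \<forall>x v1 v2.
        time_deriv (\<lambda>s. f \<alpha> s x (v1, v2)) t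
        + fst (vhat (m \<alpha>) (v1, v2)) * deriv (\<lambda>y. f \<alpha> t y (v1, v2)) x
        + e \<alpha> * (E1 t x + snd (vhat (m \<alpha>) (v1, v2)) * B t x) * deriv (\<lambda>w. f \<alpha> t x (w, v2)) v1
        + e \<alpha> * (E2 t x - fst (vhat (m \<alpha>) (v1, v2)) * B t x) * deriv (\<lambda>w. f \<alpha> t x (v1, w)) v2
        = 0) \<and>
     (\<forall>t\<ge>0. \<forall>x.
        E1 t x = 1/2 * (LBINT y:{..x}. charge_density N e f t y)
                 - 1/2 * (LBINT y:{x..}. charge_density N e f t y) \<and>
        time_deriv (\<lambda>s. E2 s x) t + deriv (\<lambda>y. B t y) x = - snd (current_density N e m f t x) \<and>
        time_deriv (\<lambda>s. B s x) t + deriv (\<lambda>y. E2 t y) x = 0) \<and>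
     (\<forall>\<alpha>\<in>{1..N}. \<forall>x v. f \<alpha> 0 x v = f0 \<alpha> x v) \<and>
     (\<forall>x. E2 0 x = E20 x) \<and> (\<forall>x. B 0 x = B0 x)"

definition neutral ::
  "nat \<Rightarrow> (nat \<Rightarrow> real) \<Rightarrow> (nat \<Rightarrow> real \<Rightarrow> real \<times> real \<Rightarrow> real) \<Rightarrow> bool" where
  "neutral N e f0 \<longleftrightarrow> (LBINT x. (LINT v|lborel. (\<Sum>\<alpha>=1..N. e \<alpha> * f0 \<alpha> x v))) = 0"

definition monocharge :: "nat \<Rightarrow> (nat \<Rightarrow> real) \<Rightarrow> (nat \<Rightarrow> real) \<Rightarrow> bool" where
  "monocharge N e m \<longleftrightarrow> N = 1 \<and> e 1 = 1 \<and> m 1 = 1"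

end

theory Submission
  imports Defs
begin

text \<open>
  The estimates are flux identities for two conservation laws. Put
  \<open>\<epsilon> = \<integral>\<Sum> f\<^sup>\<alpha> sqrt (m\<^sup>2 + |v|\<^sup>2) dv + (E\<^sub>1\<^sup>2 + E\<^sub>2\<^sup>2 + B\<^sup>2) / 2\<close> (energy density),
  \<open>\<mu> = \<integral>\<Sum> f\<^sup>\<alpha> v\<^sub>1 dv + E\<^sub>2 B\<close> (energy flux, and at the same time momentum density) and
  \<open>p = \<integral>\<Sum> f\<^sup>\<alpha> v\<^sub>1\<^sup>2 / sqrt (m\<^sup>2 + |v|\<^sup>2) dv + (E\<^sub>2\<^sup>2 + B\<^sup>2 - E\<^sub>1\<^sup>2) / 2\<close> (momentum flux). Then
  \<open>\<partial>\<^sub>t \<epsilon> + \<partial>\<^sub>x \<mu> = 0\<close> and \<open>\<partial>\<^sub>t \<mu> + \<partial>\<^sub>x p = 0\<close>, so there are potentials \<open>\<Psi>\<close>, \<open>\<Phi>\<close> with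
  \<open>\<partial>\<^sub>x \<Psi> = \<epsilon>\<close>, \<open>\<partial>\<^sub>t \<Psi> = - \<mu>\<close>, \<open>\<partial>\<^sub>x \<Phi> = \<mu>\<close>, \<open>\<partial>\<^sub>t \<Phi> = - p\<close> (lemma \<open>energy_momentum_potentials\<close>).

  Part (i). Along the line of slope \<open>\<sigma> = \<plusminus>1\<close> the derivative of \<open>\<sigma> \<Psi>\<close> is \<open>\<epsilon> - \<sigma> \<mu>\<close>, and
  \<open>2 (\<epsilon> - \<sigma> \<mu>) = E\<^sub>1\<^sup>2 + (E\<^sub>2 - \<sigma> B)\<^sup>2 + 2 \<integral>\<Sum> f\<^sup>\<alpha> (sqrt (m\<^sup>2 + |v|\<^sup>2) - \<sigma> v\<^sub>1) dv\<close> dominates the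
  integrand. The value \<open>\<Psi> (t, x)\<close> cancels in the sum of the two integrals, which is therefore at
  most twice the initial energy in \<open>[x - t, x + t]\<close>. In the neutral case \<open>E\<^sub>1\<close> vanishes initially
  outside \<open>[-C\<^sub>0, C\<^sub>0]\<close>, so the total initial energy is finite.

  Part (ii). With nonzero total charge \<open>E\<^sub>1\<close> does not decay and the energy is infinite. In
  \<open>\<epsilon> - 2 \<sigma> \<mu> + p\<close>, however, the field \<open>E\<^sub>1\<close> cancels and exactly the integrand remains; this is the
  derivative of \<open>\<sigma> (\<Psi> - \<sigma> \<Phi>)\<close> along the line of slope \<open>\<sigma>\<close>. It vanishes on the extreme ray
  \<open>x = \<sigma> (C\<^sub>0 + t)\<close>, where there are no particles and \<open>E\<^sub>2 = \<sigma> B\<close>. As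
  \<open>\<sigma> (\<Psi> - \<sigma> \<Phi>)\<close> increases in the direction \<open>\<sigma>\<close>, with rate \<open>\<epsilon> - \<sigma> \<mu> \<ge> 0\<close>, the flux through the
  given line is at most the initial amount of \<open>\<epsilon> - \<sigma> \<mu> \<le> 2 \<epsilon>\<close> on an interval of length
  \<open>C\<^sub>0 + t - \<sigma> x\<close>, and the initial \<open>\<epsilon>\<close> is bounded.

  The regularity behind it comes from compact support. Moving backward in time along a straight
  line with the velocity of the transport equation stays inside a backward cone, because the
  \<open>x\<close>-speed is at most 1 and the force is bounded there; a maximum principle then bounds \<open>f\<^sup>\<alpha>\<close> on
  the cone by its initial values (\<open>transport_max_principle\<close>, \<open>domain_of_dependence\<close>), so that no
  characteristic flow has to be constructed. Thus \<open>f\<^sup>\<alpha> \<ge> 0\<close>, and the momentum support is bounded on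
  bounded time intervals, which permits differentiation under the integral and integration by
  parts in \<open>v\<close> (\<open>moment_balance\<close>).
\<close>

section \<open>Derivatives along curves and a maximum principle for transport equations\<close>

lemma time_deriv_eq:
  assumes "0 \<le> t" "(g has_vector_derivative d) (at t within {0..})"
  shows "time_deriv g t = d"
  unfolding time_deriv_def
proof (rule vector_derivative_within[OF _ assms(2)])
  have "at t within {t<..} \<le> at t within {0..}"
    using assms(1) by (intro at_le) auto
  then show "at t within {0..} \<noteq> bot"
    using trivial_limit_at_right_real[of t] by (metis bot.extremum_uniqueI)
qed

lemma has_real_derivative_along_curve:
  fixes g :: "'a::real_normed_vector \<Rightarrow> real" and p :: "real \<Rightarrow> 'a"
  assumes "(g has_derivative G) (at (p s) within H)"
    and "(p has_vector_derivative d) (at s within I)"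
    and "\<And>r. r \<in> I \<Longrightarrow> p r \<in> H"
  shows "((\<lambda>r. g (p r)) has_real_derivative G d) (at s within I)"
proof -
  have "(g has_derivative G) (at (p s) within p ` I)"
    by (rule has_derivative_subset[OF assms(1)]) (use assms(3) in auto)
  from has_derivative_in_compose[OF assms(2)[unfolded has_vector_derivative_def] this]
  have "((\<lambda>r. g (p r)) has_derivative (\<lambda>h. G (h *\<^sub>R d))) (at s within I)" .
  then show ?thesis
    using linear_scale[OF has_derivative_linear[OF assms(1)]]
    by (simp add: has_field_derivative_def mult.commute[of _ "G d"])
qed

text \<open>
If \<open>g - \<epsilon> t\<close> had its maximum over \<open>S\<close> at a point with \<open>t > 0\<close>, one could move from there a little
backward along the direction in which \<open>g\<close> is stationary; this stays in \<open>S\<close> and decreases \<open>\<epsilon> t\<close>, so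
it increases \<open>g - \<epsilon> t\<close> to first order. Hence the maximum is attained at \<open>t = 0\<close>; then \<open>\<epsilon> \<rightarrow> 0\<close>.
\<close>
lemma transport_max_principle:
  fixes g :: "real \<times> 'a::real_normed_vector \<Rightarrow> real"
  assumes "compact S"
    and nonneg: "\<And>z. z \<in> S \<Longrightarrow> 0 \<le> fst z"
    and deriv: "\<And>z. z \<in> S \<Longrightarrow> (g has_derivative G z) (at z within {0..} \<times> UNIV)"
    and backward: "\<And>z. z \<in> S \<Longrightarrow> 0 < fst z \<Longrightarrow>
                 \<exists>d. G z (1, d) = 0 \<and> (\<forall>s\<in>{0..fst z}. z - s *\<^sub>R (1, d) \<in> S)"
    and init: "\<And>z. z \<in> S \<Longrightarrow> fst z = 0 \<Longrightarrow> g z \<le> M"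
    and "z \<in> S"
  shows "g z \<le> M"
proof -
  have SH: "S \<subseteq> {0..} \<times> UNIV"
    using nonneg by (auto simp: mem_Times_iff)
  have bound: "g z \<le> M + \<epsilon> * fst z" if "0 < \<epsilon>" for \<epsilon>
  proof -
    have "continuous_on S (\<lambda>z. g z - \<epsilon> * fst z)"
      using deriv SH
      by (intro continuous_intros)
        (meson has_derivative_continuous_on has_derivative_subset)
    then obtain z0 where z0: "z0 \<in> S" "\<And>z. z \<in> S \<Longrightarrow> g z - \<epsilon> * fst z \<le> g z0 - \<epsilon> * fst z0"
      using continuous_attains_sup[OF \<open>compact S\<close>] \<open>z \<in> S\<close> by blast
    have "fst z0 = 0"
    proof (rule ccontr)
      assume "fst z0 \<noteq> 0"
      then have pos: "0 < fst z0"
        using nonneg[OF z0(1)] by simp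
      obtain d where d: "G z0 (1, d) = 0" "\<forall>s\<in>{0..fst z0}. z0 - s *\<^sub>R (1, d) \<in> S"
        using backward[OF z0(1) pos] by blast
      define I where "I = {0..fst z0}"
      have curve: "((\<lambda>s. z0 - s *\<^sub>R (1, d)) has_vector_derivative - (1, d)) (at 0 within I)"
        by (auto simp: has_vector_derivative_def intro!: derivative_eq_intros)
      have "((\<lambda>s. g (z0 - s *\<^sub>R (1, d))) has_real_derivative G z0 (- (1, d))) (at 0 within I)"
      proof (rule has_real_derivative_along_curve[OF _ curve])
        show "(g has_derivative G z0) (at (z0 - 0 *\<^sub>R (1, d)) within {0..} \<times> UNIV)"
          using deriv[OF z0(1)] by (simp flip: zero_prod_def)
        show "z0 - r *\<^sub>R (1, d) \<in> {0..} \<times> UNIV" if "r \<in> I" for r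
          using that d(2) SH unfolding I_def by blast
      qed
      moreover have "G z0 (- (1, d)) = 0"
        using d(1) linear_neg[OF has_derivative_linear[OF deriv[OF z0(1)]], of "(1, d)"] by simp
      ultimately have "((\<lambda>s. g (z0 - s *\<^sub>R (1, d))) has_real_derivative 0) (at 0 within I)"
        by simp
      then have "((\<lambda>s. g (z0 - s *\<^sub>R (1, d)) - \<epsilon> * (fst z0 - s)) has_real_derivative \<epsilon>) (at 0 within I)"
        by (auto intro!: derivative_eq_intros)
      from has_real_derivative_pos_inc_right[OF this \<open>0 < \<epsilon>\<close>] obtain \<delta> where \<delta>: "\<delta> > 0"
        "\<And>h. 0 < h \<Longrightarrow> 0 + h \<in> I \<Longrightarrow> h < \<delta> \<Longrightarrow>
           g (z0 - 0 *\<^sub>R (1, d)) - \<epsilon> * (fst z0 - 0)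
           < g (z0 - (0 + h) *\<^sub>R (1, d)) - \<epsilon> * (fst z0 - (0 + h))"
        by blast
      define h where "h = min (\<delta> / 2) (fst z0)"
      have h: "0 < h" "h \<in> I" "h < \<delta>"
        using \<delta>(1) pos by (auto simp: h_def I_def)
      have "g z0 - \<epsilon> * fst z0 < g (z0 - h *\<^sub>R (1, d)) - \<epsilon> * fst (z0 - h *\<^sub>R (1, d))"
        using \<delta>(2)[of h] h by (simp flip: zero_prod_def)
      moreover have "z0 - h *\<^sub>R (1, d) \<in> S"
        using d(2) h(2) by (auto simp: I_def)
      ultimately show False
        using z0(2) by fastforce
    qed
    then show ?thesis
      using z0(2)[OF \<open>z \<in> S\<close>] init[OF z0(1)] by simp
  qed
  show ?thesis
  proof (rule field_le_epsilon)
    fix \<epsilon> :: real assume "0 < \<epsilon>"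
    have n: "0 \<le> fst z" using nonneg \<open>z \<in> S\<close> by simp
    \<comment> \<open>the summand 1 because \<open>fst z\<close> may be zero\<close>
    have "g z \<le> M + \<epsilon> / (fst z + 1) * fst z"
      using \<open>0 < \<epsilon>\<close> n by (intro bound) auto
    also have "\<dots> \<le> M + \<epsilon>"
      using \<open>0 < \<epsilon>\<close> n by (simp add: field_simps)
    finally show "g z \<le> M + \<epsilon>" .
  qed
qed

section \<open>Integrals of compactly supported functions\<close>

text \<open>
This turns the moments, which are Lebesgue integrals over the whole momentum space, into gauge
integrals over a box, which can be differentiated under the integral sign and integrated by parts.
\<close>
lemma lebesgue_integral_eq_box:
  fixes h :: "'a::euclidean_space \<Rightarrow> 'b::euclidean_space"
  assumes "continuous_on (cbox a b) h" "\<And>v. v \<notin> cbox a b \<Longrightarrow> h v = 0"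
  shows "integrable lborel h" "(LINT v|lborel. h v) = integral (cbox a b) h"
proof -
  have eq: "(\<lambda>v. indicator (cbox a b) v *\<^sub>R h v) = h"
    using assms(2) by (auto simp: fun_eq_iff indicator_def)
  have "set_integrable lborel (cbox a b) h"
    unfolding set_integrable_def using assms(1) by (intro borel_integrable_compact) auto
  from this set_borel_integral_eq_integral(2)[OF this] show "integrable lborel h"
    "(LINT v|lborel. h v) = integral (cbox a b) h"
    unfolding set_integrable_def set_lebesgue_integral_def eq by auto
qed

lemma set_lebesgue_integral_eq_integral_Icc:
  fixes g :: "real \<Rightarrow> real"
  assumes "continuous_on {a..b} g"
  shows "(LBINT \<tau>:{a..b}. g \<tau>) = integral {a..b} g"
  using borel_integrable_compact[OF compact_Icc assms]
  by (intro set_borel_integral_eq_integral) (simp add: set_integrable_def)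

lemma integral_partial_derivative_fst_eq_0:
  fixes h :: "real \<times> real \<Rightarrow> real"
  assumes "\<And>x y. ((\<lambda>x. h (x, y)) has_real_derivative h' (x, y)) (at x)"
    and "continuous_on UNIV h'" and "a \<le> b"
    and "\<And>y. h (a, y) = 0" "\<And>y. h (b, y) = 0"
  shows "integral (cbox (a, c) (b, d)) h' = 0"
proof -
  have inner: "integral {a..b} (\<lambda>x. h' (x, y)) = 0" for y
  proof -
    have "((\<lambda>x. h' (x, y)) has_integral h (b, y) - h (a, y)) {a..b}"
      using assms(1,3)
      by (intro fundamental_theorem_of_calculus)
        (auto simp flip: has_real_derivative_iff_has_vector_derivative
          intro: has_field_derivative_at_within)
    then show ?thesis using assms(4,5) by (simp add: integral_unique)
  qed
  have c: "continuous_on (cbox (a, c) (b, d)) h'"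
    using assms(2) continuous_on_subset by blast
  have "integral (cbox (a, c) (b, d)) h'
      = integral (cbox a b) (\<lambda>x. integral (cbox c d) (\<lambda>y. h' (x, y)))"
    by (rule integral_prod_continuous[OF c])
  also have "\<dots> = integral (cbox c d) (\<lambda>y. integral (cbox a b) (\<lambda>x. h' (x, y)))"
    using c by (intro integral_swap_continuous) (simp add: case_prod_beta')
  finally show ?thesis by (simp add: inner)
qed

lemma integral_partial_derivative_snd_eq_0:
  fixes h :: "real \<times> real \<Rightarrow> real"
  assumes "\<And>x y. ((\<lambda>y. h (x, y)) has_real_derivative h' (x, y)) (at y)"
    and "continuous_on UNIV h'" and "c \<le> d"
    and "\<And>x. h (x, c) = 0" "\<And>x. h (x, d) = 0"
  shows "integral (cbox (a, c) (b, d)) h' = 0"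
proof -
  have inner: "integral {c..d} (\<lambda>y. h' (x, y)) = 0" for x
  proof -
    have "((\<lambda>y. h' (x, y)) has_integral h (x, d) - h (x, c)) {c..d}"
      using assms(1,3)
      by (intro fundamental_theorem_of_calculus)
        (auto simp flip: has_real_derivative_iff_has_vector_derivative
          intro: has_field_derivative_at_within)
    then show ?thesis using assms(4,5) by (simp add: integral_unique)
  qed
  have c: "continuous_on (cbox (a, c) (b, d)) h'"
    using assms(2) continuous_on_subset by blast
  show ?thesis
    by (subst integral_prod_continuous[OF c]) (simp add: inner)
qed

section \<open>Continuously differentiable functions on a time strip\<close>

abbreviation strip :: "real \<Rightarrow> (real \<times> real) set" where
  "strip T \<equiv> {0..T} \<times> UNIV"

text \<open>
\<open>P\<close> is continuously differentiable on the strip, one-sidedly at its two edges, with time derivative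
\<open>Pt\<close> and space derivative \<open>Px\<close>.
\<close>
definition has_partials_on ::
  "real \<Rightarrow> (real \<times> real \<Rightarrow> real) \<Rightarrow> (real \<times> real \<Rightarrow> real) \<Rightarrow> (real \<times> real \<Rightarrow> real) \<Rightarrow> bool" where
  "has_partials_on T P Pt Px \<longleftrightarrow>
     (\<forall>z\<in>strip T. (P has_derivative (\<lambda>h. fst h * Pt z + snd h * Px z)) (at z within strip T)) \<and>
     continuous_on (strip T) Pt \<and> continuous_on (strip T) Px"

lemma has_partials_on_continuous: "has_partials_on T P Pt Px \<Longrightarrow> continuous_on (strip T) P"
  unfolding has_partials_on_def
  by (rule has_derivative_continuous_on[where f' = "\<lambda>z h. fst h * Pt z + snd h * Px z"]) blast

lemma has_partials_on_add:
  "has_partials_on T P Pt Px \<Longrightarrow> has_partials_on T Q Qt Qx \<Longrightarrow>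
   has_partials_on T (\<lambda>z. P z + Q z) (\<lambda>z. Pt z + Qt z) (\<lambda>z. Px z + Qx z)"
  unfolding has_partials_on_def
  by (intro conjI ballI continuous_intros; (elim conjE)?;
      (assumption | drule (1) bspec | rule has_derivative_eq_rhs[OF has_derivative_add]
       | simp add: fun_eq_iff algebra_simps)+)

lemma has_partials_on_cmult:
  "has_partials_on T P Pt Px \<Longrightarrow>
   has_partials_on T (\<lambda>z. c * P z) (\<lambda>z. c * Pt z) (\<lambda>z. c * Px z)"
  unfolding has_partials_on_def
  by (auto intro!: derivative_eq_intros continuous_intros simp: algebra_simps)

lemma has_partials_on_mult:
  assumes "has_partials_on T P Pt Px" "has_partials_on T Q Qt Qx"
  shows "has_partials_on T (\<lambda>z. P z * Q z)
     (\<lambda>z. Pt z * Q z + P z * Qt z) (\<lambda>z. Px z * Q z + P z * Qx z)"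
  using assms has_partials_on_continuous[OF assms(1)] has_partials_on_continuous[OF assms(2)]
  unfolding has_partials_on_def
  by (auto intro!: derivative_eq_intros continuous_intros simp: algebra_simps)

lemma has_partials_on_sum:
  assumes "\<And>i. i \<in> I \<Longrightarrow> has_partials_on T (P i) (Pt i) (Px i)"
  shows "has_partials_on T (\<lambda>z. \<Sum>i\<in>I. P i z) (\<lambda>z. \<Sum>i\<in>I. Pt i z) (\<lambda>z. \<Sum>i\<in>I. Px i z)"
  using assms unfolding has_partials_on_def
  by (auto intro!: derivative_eq_intros continuous_intros
      simp: sum_distrib_left sum.distrib)

lemma has_partials_on_cong:
  assumes "has_partials_on T P Pt Px"
    "\<And>z. z \<in> strip T \<Longrightarrow> P z = P' z" "\<And>z. z \<in> strip T \<Longrightarrow> Pt z = Pt' z"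
    "\<And>z. z \<in> strip T \<Longrightarrow> Px z = Px' z"
  shows "has_partials_on T P' Pt' Px'"
proof -
  have "(P' has_derivative (\<lambda>h. fst h * Pt' z + snd h * Px' z)) (at z within strip T)"
    if "z \<in> strip T" for z
    using assms(1) that unfolding has_partials_on_def
    by (intro has_derivative_transform[of z "strip T" P' P]) (auto simp flip: assms(2-4))
  moreover have "continuous_on (strip T) Pt'" "continuous_on (strip T) Px'"
    using assms(1) unfolding has_partials_on_def
    by (simp_all add: assms(3,4) cong: continuous_on_cong)
  ultimately show ?thesis
    unfolding has_partials_on_def by blast
qed

lemma has_partials_on_curve:
  assumes "has_partials_on T P Pt Px" "p s \<in> strip T"
    and "(p has_vector_derivative d) (at s within I)" "\<And>r. r \<in> I \<Longrightarrow> p r \<in> strip T"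
  shows "((\<lambda>r. P (p r)) has_real_derivative fst d * Pt (p s) + snd d * Px (p s)) (at s within I)"
  by (rule has_real_derivative_along_curve[where H = "strip T"])
    (use assms in \<open>auto simp: has_partials_on_def\<close>)

lemma has_partials_on_fst:
  assumes "has_partials_on T P Pt Px" "t \<in> {0..T}"
  shows "((\<lambda>s. P (s, x)) has_real_derivative Pt (t, x)) (at t within {0..T})"
proof -
  have "((\<lambda>s. (s, x)) has_vector_derivative (1, 0)) (at t within {0..T})"
    by (auto simp: has_vector_derivative_def intro!: derivative_eq_intros)
  from has_partials_on_curve[OF assms(1) _ this] assms(2) show ?thesis
    by simp
qed

lemma has_partials_on_snd:
  assumes "has_partials_on T P Pt Px" "t \<in> {0..T}"
  shows "((\<lambda>y. P (t, y)) has_real_derivative Px (t, x)) (at x)"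
proof -
  have "(Pair t has_vector_derivative (0, 1)) (at x)"
    by (auto simp: has_vector_derivative_def intro!: derivative_eq_intros)
  from has_partials_on_curve[OF assms(1) _ this] assms(2) show ?thesis
    by simp
qed

lemma has_partials_onI:
  assumes "\<And>t x. t \<in> {0..T} \<Longrightarrow> ((\<lambda>s. P (s, x)) has_real_derivative Pt (t, x)) (at t within {0..T})"
    and "\<And>t x. t \<in> {0..T} \<Longrightarrow> ((\<lambda>y. P (t, y)) has_real_derivative Px (t, x)) (at x)"
    and "continuous_on (strip T) Pt" "continuous_on (strip T) Px"
  shows "has_partials_on T P Pt Px"
  unfolding has_partials_on_def
proof (intro conjI ballI)
  fix z assume "z \<in> strip T"
  then obtain t x where z: "z = (t, x)" and t: "t \<in> {0..T}"
    by auto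
  have "((\<lambda>(t, x). P (t, x)) has_derivative
      (\<lambda>(h, k). Pt (t, x) * h + blinfun_apply (blinfun_mult_right (Px (t, x))) k))
      (at (t, x) within strip T)"
  proof (rule has_derivative_partialsI)
    show "((\<lambda>s. P (s, x)) has_derivative (*) (Pt (t, x))) (at t within {0..T})"
      using assms(1)[OF t] by (simp add: has_field_derivative_def)
    show "((\<lambda>y. P (s, y)) has_derivative blinfun_apply (blinfun_mult_right (Px (s, y)))) (at y within UNIV)"
      if "s \<in> {0..T}" for s y
      using assms(2)[OF that] by (simp add: has_field_derivative_def)
    have "continuous_on (strip T) (\<lambda>z. blinfun_mult_right (Px z))"
      using assms(4) by (intro bounded_linear.continuous_on[OF bounded_linear_blinfun_mult_right])
    then show "continuous (at (t, x) within strip T) (\<lambda>(s, y). blinfun_mult_right (Px (s, y)))"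
      using t by (simp add: continuous_on_eq_continuous_within case_prod_beta')
  qed auto
  then show "(P has_derivative (\<lambda>h. fst h * Pt z + snd h * Px z)) (at z within strip T)"
    by (simp add: z case_prod_beta' mult.commute)
qed (use assms in auto)

text \<open>
Differentiation under the integral sign, in the form needed for momentum integrals, where the
parameter is a point of the strip.
\<close>
lemma has_partials_on_box_integral:
  fixes g :: "real \<times> real \<Rightarrow> 'b::euclidean_space \<Rightarrow> real"
  assumes "\<And>t x v. t \<in> {0..T} \<Longrightarrow> v \<in> cbox a b \<Longrightarrow>
             ((\<lambda>s. g (s, x) v) has_real_derivative gt (t, x) v) (at t within {0..T})"
    and "\<And>t x v. t \<in> {0..T} \<Longrightarrow> v \<in> cbox a b \<Longrightarrow>
             ((\<lambda>y. g (t, y) v) has_real_derivative gx (t, x) v) (at x)"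
    and g: "continuous_on (strip T \<times> cbox a b) (\<lambda>(z, v). g z v)"
    and gt: "continuous_on (strip T \<times> cbox a b) (\<lambda>(z, v). gt z v)"
    and gx: "continuous_on (strip T \<times> cbox a b) (\<lambda>(z, v). gx z v)"
  shows "has_partials_on T (\<lambda>z. integral (cbox a b) (g z))
           (\<lambda>z. integral (cbox a b) (gt z)) (\<lambda>z. integral (cbox a b) (gx z))"
proof (rule has_partials_onI)
  have int: "g z integrable_on cbox a b" if "z \<in> strip T" for z
  proof (rule integrable_continuous)
    have "continuous_on (cbox a b) (\<lambda>v. (\<lambda>(z, v). g z v) (z, v))"
      by (rule continuous_on_compose2[OF g]) (use that in \<open>auto intro!: continuous_intros\<close>)
    then show "continuous_on (cbox a b) (g z)" by simp
  qed
  fix t x :: real assume t: "t \<in> {0..T}"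
  have "continuous_on ({0..T} \<times> cbox a b) (\<lambda>p. (\<lambda>(z, v). gt z v) ((fst p, x), snd p))"
    by (rule continuous_on_compose2[OF gt]) (auto intro!: continuous_intros)
  then show "((\<lambda>s. integral (cbox a b) (g (s, x))) has_real_derivative integral (cbox a b) (gt (t, x)))
      (at t within {0..T})"
    by (intro leibniz_rule_field_derivative[where fx = "\<lambda>s. gt (s, x)"])
      (use assms(1) int t in \<open>auto simp: case_prod_beta'\<close>)
  have "continuous_on (UNIV \<times> cbox a b) (\<lambda>p. (\<lambda>(z, v). gx z v) ((t, fst p), snd p))"
    by (rule continuous_on_compose2[OF gx]) (use t in \<open>auto intro!: continuous_intros\<close>)
  then show "((\<lambda>y. integral (cbox a b) (g (t, y))) has_real_derivative integral (cbox a b) (gx (t, x))) (at x)"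
    by (intro leibniz_rule_field_derivative[where fx = "\<lambda>y. gx (t, y)" and U = UNIV, simplified])
      (use assms(2) int t in \<open>auto simp: case_prod_beta'\<close>)
qed (use gt gx in \<open>auto intro: integral_continuous_on_param\<close>)

text \<open>
The Poincare lemma for the closed form \<open>P dx - Q dt\<close>: take an antiderivative of \<open>P (0, \<cdot>)\<close> and subtract
the time integral of \<open>Q\<close>. Its space derivative at time \<open>t\<close> is \<open>P (0, x) - \<integral>\<^sub>0\<^sup>t \<partial>\<^sub>x Q = P (0, x) + \<integral>\<^sub>0\<^sup>t \<partial>\<^sub>t P\<close>.
With a potential, every use of the divergence theorem on a region bounded by lines becomes the
fundamental theorem of calculus along these lines.
\<close>
lemma conservation_law_potential:
  assumes P: "has_partials_on T P Pt Px" and Q: "has_partials_on T Q Qt Qx"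
    and law: "\<And>z. z \<in> strip T \<Longrightarrow> Pt z + Qx z = 0" and "0 \<le> T"
  obtains \<Psi> where "has_partials_on T \<Psi> (\<lambda>z. - Q z) P"
proof -
  have contP: "continuous_on (strip T) P" and contQ: "continuous_on (strip T) Q"
    and contQx: "continuous_on (strip T) Qx"
    using P Q by (auto simp: has_partials_on_continuous) (simp add: has_partials_on_def)
  have "isCont (\<lambda>y. P (0, y)) x" for x
    using has_partials_on_snd[OF P, of 0 x] \<open>0 \<le> T\<close> by (auto intro: DERIV_isCont)
  then obtain G where "\<And>x. (G has_vector_derivative P (0, x)) (at x)"
    using einterval_antiderivative[of "-\<infinity>" "\<infinity>" "\<lambda>y. P (0, y)"] by auto
  then have G: "(G has_real_derivative P (0, x)) (at x)" for x
    by (simp add: has_real_derivative_iff_has_vector_derivative)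
  define \<Psi> where "\<Psi> = (\<lambda>z. G (snd z) - integral {0..fst z} (\<lambda>\<tau>. Q (\<tau>, snd z)))"
  have "has_partials_on T \<Psi> (\<lambda>z. - Q z) P"
  proof (rule has_partials_onI)
    fix t x :: real assume t: "t \<in> {0..T}"
    have "continuous_on {0..T} (\<lambda>\<tau>. Q (\<tau>, x))"
      by (rule continuous_on_compose2[OF contQ]) (auto intro!: continuous_intros)
    from integral_has_real_derivative[OF this t]
    show "((\<lambda>s. \<Psi> (s, x)) has_real_derivative - Q (t, x)) (at t within {0..T})"
      unfolding \<Psi>_def by (auto intro!: derivative_eq_intros)
    have "continuous_on (UNIV \<times> cbox 0 t) (\<lambda>p. Qx (snd p, fst p))"
      by (rule continuous_on_compose2[OF contQx]) (use t in \<open>auto intro!: continuous_intros\<close>)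
    moreover have "continuous_on {0..t} (\<lambda>\<tau>. Q (\<tau>, y))" for y
      by (rule continuous_on_compose2[OF contQ]) (use t in \<open>auto intro!: continuous_intros\<close>)
    ultimately have "((\<lambda>y. integral {0..t} (\<lambda>\<tau>. Q (\<tau>, y))) has_real_derivative
        integral {0..t} (\<lambda>\<tau>. Qx (\<tau>, x))) (at x)"
      using t by (intro leibniz_rule_field_derivative[where U = UNIV and a = 0 and b = t
              and fx = "\<lambda>y \<tau>. Qx (\<tau>, y)", simplified])
        (auto intro!: has_partials_on_snd[OF Q] integrable_continuous_real simp: case_prod_beta')
    moreover have "integral {0..t} (\<lambda>\<tau>. Qx (\<tau>, x)) = P (0, x) - P (t, x)"
    proof -
      have "((\<lambda>\<tau>. Pt (\<tau>, x)) has_integral P (t, x) - P (0, x)) {0..t}"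
        using t
        by (intro fundamental_theorem_of_calculus)
          (auto simp flip: has_real_derivative_iff_has_vector_derivative
            intro!: DERIV_subset[OF has_partials_on_fst[OF P]])
      then have "((\<lambda>\<tau>. Qx (\<tau>, x)) has_integral - (P (t, x) - P (0, x))) {0..t}"
        by (rule has_integral_eq[rotated, OF has_integral_neg])
          (use law t in \<open>auto simp: add_eq_0_iff\<close>)
      then show ?thesis by (simp add: integral_unique)
    qed
    ultimately show "((\<lambda>y. \<Psi> (t, y)) has_real_derivative P (t, x)) (at x)"
      unfolding \<Psi>_def by (auto intro!: derivative_eq_intros G)
  qed (use contP contQ in \<open>auto intro: continuous_intros\<close>)
  then show ?thesis by (rule that)
qed

lemma has_integral_along_line:
  assumes "has_partials_on T P Pt Px" "t \<in> {0..T}"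
  shows "((\<lambda>\<tau>. Pt (\<tau>, x + c * (\<tau> - t)) + c * Px (\<tau>, x + c * (\<tau> - t)))
            has_integral P (t, x) - P (0, x - c * t)) {0..t}"
proof -
  have "((\<lambda>\<tau>. (\<tau>, x + c * (\<tau> - t))) has_vector_derivative (1, c)) (at \<tau> within {0..t})" for \<tau>
    by (auto simp: has_vector_derivative_def intro!: derivative_eq_intros)
  from has_partials_on_curve[OF assms(1) _ this]
  have "((\<lambda>\<tau>. P (\<tau>, x + c * (\<tau> - t))) has_real_derivative
      Pt (\<tau>, x + c * (\<tau> - t)) + c * Px (\<tau>, x + c * (\<tau> - t))) (at \<tau> within {0..t})"
    if "\<tau> \<in> {0..t}" for \<tau>
    using that assms(2) by auto
  then show ?thesis
    using fundamental_theorem_of_calculus[of 0 t "\<lambda>\<tau>. P (\<tau>, x + c * (\<tau> - t))"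
       "\<lambda>\<tau>. Pt (\<tau>, x + c * (\<tau> - t)) + c * Px (\<tau>, x + c * (\<tau> - t))"] assms(2)
    by (auto simp flip: has_real_derivative_iff_has_vector_derivative)
qed

lemma has_partials_on_const: "has_partials_on T (\<lambda>z. c) (\<lambda>z. 0) (\<lambda>z. 0)"
  by (simp add: has_partials_on_def)

lemma has_partials_on_minus:
  assumes "has_partials_on T P Pt Px" "has_partials_on T Q Qt Qx"
  shows "has_partials_on T (\<lambda>z. P z - Q z) (\<lambda>z. Pt z - Qt z) (\<lambda>z. Px z - Qx z)"
  using has_partials_on_add[OF assms(1) has_partials_on_cmult[OF assms(2), of "-1"]] by simp

lemma has_partials_on_snd_integral:
  assumes "has_partials_on T P Pt Px" "t \<in> {0..T}" "a \<le> b"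
  shows "(LBINT y:{a..b}. Px (t, y)) = P (t, b) - P (t, a)"
proof -
  have "continuous_on {a..b} (\<lambda>y. Px (t, y))"
    using assms(1,2) unfolding has_partials_on_def
    by (auto intro!: continuous_on_compose2[of "strip T" Px _ "Pair t"] continuous_intros)
  moreover have "((\<lambda>y. Px (t, y)) has_integral P (t, b) - P (t, a)) {a..b}"
    using assms(3) has_partials_on_snd[OF assms(1,2)]
    by (intro fundamental_theorem_of_calculus)
      (auto simp flip: has_real_derivative_iff_has_vector_derivative
        intro: has_field_derivative_at_within)
  ultimately show ?thesis
    by (simp add: set_lebesgue_integral_eq_integral_Icc integral_unique)
qed

lemma deriv_zero_imp_eq:
  fixes g :: "real \<Rightarrow> real"
  assumes "\<And>x. a \<le> x \<Longrightarrow> x \<le> b \<Longrightarrow> (g has_real_derivative 0) (at x)" "a \<le> b"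
  shows "g a = g b"
proof (rule antisym)
  show "g a \<le> g b"
    by (rule DERIV_nonneg_imp_nondecreasing[OF assms(2)]) (use assms(1) in blast)
  show "g b \<le> g a"
    by (rule DERIV_nonpos_imp_nonincreasing[OF assms(2)]) (use assms(1) in blast)
qed

section \<open>Relativistic energy and velocity\<close>

definition rel_energy :: "real \<Rightarrow> real \<times> real \<Rightarrow> real" where
  "rel_energy \<mu> v = sqrt (\<mu>\<^sup>2 + (norm v)\<^sup>2)"

lemma rel_energy_pos: "0 < \<mu> \<Longrightarrow> 0 < rel_energy \<mu> v"
  by (simp add: rel_energy_def add_pos_nonneg)

lemma fst_vhat: "fst (vhat \<mu> v) = fst v / rel_energy \<mu> v"
  and snd_vhat: "snd (vhat \<mu> v) = snd v / rel_energy \<mu> v"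
  by (simp_all add: vhat_def rel_energy_def divide_inverse_commute)

lemma abs_fst_le_rel_energy: "\<bar>fst v\<bar> \<le> rel_energy \<mu> v"
  and abs_snd_le_rel_energy: "\<bar>snd v\<bar> \<le> rel_energy \<mu> v"
  by (auto simp: rel_energy_def norm_prod_def intro!: real_le_rsqrt)

lemma abs_vhat_le_1:
  assumes "0 < \<mu>"
  shows "\<bar>fst (vhat \<mu> v)\<bar> \<le> 1" "\<bar>snd (vhat \<mu> v)\<bar> \<le> 1"
  using rel_energy_pos[OF assms, of v] abs_fst_le_rel_energy[of v \<mu>] abs_snd_le_rel_energy[of v \<mu>]
  by (simp_all add: fst_vhat snd_vhat)

lemma continuous_on_rel_energy [continuous_intros]:
  "continuous_on S g \<Longrightarrow> continuous_on S (\<lambda>z. rel_energy \<mu> (g z))"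
  unfolding rel_energy_def by (intro continuous_intros)

lemma continuous_on_vhat:
  assumes "0 < \<mu>" "continuous_on S g"
  shows "continuous_on S (\<lambda>z. fst (vhat \<mu> (g z)))" "continuous_on S (\<lambda>z. snd (vhat \<mu> (g z)))"
proof -
  have "rel_energy \<mu> (g z) \<noteq> 0" for z
    using rel_energy_pos[OF assms(1), of "g z"] by simp
  then show "continuous_on S (\<lambda>z. fst (vhat \<mu> (g z)))" "continuous_on S (\<lambda>z. snd (vhat \<mu> (g z)))"
    using assms(2) by (auto simp: fst_vhat snd_vhat intro!: continuous_intros)
qed

lemma rel_energy_has_derivative:
  assumes "0 < \<mu>"
  shows "((\<lambda>x. rel_energy \<mu> (x, y)) has_real_derivative fst (vhat \<mu> (x, y))) (at x)"
    and "((\<lambda>y. rel_energy \<mu> (x, y)) has_real_derivative snd (vhat \<mu> (x, y))) (at y)"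
  using rel_energy_pos[OF assms, of "(x, y)"] unfolding fst_vhat snd_vhat
  by (auto simp: rel_energy_def norm_Pair field_simps intro!: derivative_eq_intros)

text \<open>
The equality of the two cross derivatives says that the velocity field is a gradient in momentum
space; it makes the magnetic force divergence free.
\<close>
lemma vhat_cross_derivatives:
  assumes "0 < \<mu>"
  shows "((\<lambda>x. snd (vhat \<mu> (x, y))) has_real_derivative - x * y / rel_energy \<mu> (x, y) ^ 3) (at x)"
    and "((\<lambda>y. fst (vhat \<mu> (x, y))) has_real_derivative - x * y / rel_energy \<mu> (x, y) ^ 3) (at y)"
  using rel_energy_pos[OF assms, of "(x, y)"] unfolding fst_vhat snd_vhat
  by (auto intro!: derivative_eq_intros rel_energy_has_derivative[OF assms]
      simp: fst_vhat snd_vhat field_simps power3_eq_cube)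

section \<open>Solutions and their initial energy\<close>

text \<open>
The constants of the theorem must be chosen before the solution, so the initial energy density is
defined from the data alone.
\<close>
definition initial_E1 ::
  "nat \<Rightarrow> (nat \<Rightarrow> real) \<Rightarrow> (nat \<Rightarrow> real \<Rightarrow> real \<times> real \<Rightarrow> real) \<Rightarrow> real \<Rightarrow> real" where
  "initial_E1 N e f0 x =
     1/2 * (LBINT y:{..x}. charge_density N e (\<lambda>\<alpha> t. f0 \<alpha>) 0 y)
     - 1/2 * (LBINT y:{x..}. charge_density N e (\<lambda>\<alpha> t. f0 \<alpha>) 0 y)"

definition initial_energy ::
  "nat \<Rightarrow> (nat \<Rightarrow> real) \<Rightarrow> (nat \<Rightarrow> real) \<Rightarrow> (nat \<Rightarrow> real \<Rightarrow> real \<times> real \<Rightarrow> real)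
     \<Rightarrow> (real \<Rightarrow> real) \<Rightarrow> (real \<Rightarrow> real) \<Rightarrow> real \<Rightarrow> real" where
  "initial_energy N e m f0 E20 B0 x =
     (\<Sum>\<alpha>=1..N. LINT v|lborel. rel_energy (m \<alpha>) v * f0 \<alpha> x v)
     + ((initial_E1 N e f0 x)\<^sup>2 + (E20 x)\<^sup>2 + (B0 x)\<^sup>2) / 2"

locale vlasov_maxwell =
  fixes N :: nat and e m :: "nat \<Rightarrow> real"
    and f0 :: "nat \<Rightarrow> real \<Rightarrow> real \<times> real \<Rightarrow> real" and E20 B0 :: "real \<Rightarrow> real" and C0 :: real
    and f :: "nat \<Rightarrow> real \<Rightarrow> real \<Rightarrow> real \<times> real \<Rightarrow> real"
    and E1 E2 B :: "real \<Rightarrow> real \<Rightarrow> real"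
  assumes mass_pos: "\<And>\<alpha>. \<alpha> \<in> {1..N} \<Longrightarrow> 0 < m \<alpha>"
    and data: "admissible_data N f0 E20 B0"
    and C0_pos: "0 < C0"
    and vanish: "data_vanish_outside N f0 E20 B0 C0"
    and solution: "global_C1_solution N e m f0 E20 B0 f E1 E2 B"
begin

definition force :: "nat \<Rightarrow> real \<times> real \<Rightarrow> real \<times> real \<Rightarrow> real \<times> real" where
  "force \<alpha> z v =
     (e \<alpha> * (E1 (fst z) (snd z) + snd (vhat (m \<alpha>) v) * B (fst z) (snd z)),
      e \<alpha> * (E2 (fst z) (snd z) - fst (vhat (m \<alpha>) v) * B (fst z) (snd z)))"

lemma initial_values:
  "\<alpha> \<in> {1..N} \<Longrightarrow> f \<alpha> 0 x v = f0 \<alpha> x v" "E2 0 x = E20 x" "B 0 x = B0 x"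
  using solution unfolding global_C1_solution_def by (simp_all del: split_paired_All)

text \<open>
The Vlasov equation says that the total derivative of \<open>f \<alpha>\<close> annihilates the characteristic direction.
\<close>
lemma vlasov_derivative:
  assumes "\<alpha> \<in> {1..N}"
  obtains D where
    "\<And>z. z \<in> {0..} \<times> UNIV \<Longrightarrow>
       ((\<lambda>(t, x, v). f \<alpha> t x v) has_derivative blinfun_apply (D z)) (at z within {0..} \<times> UNIV)"
    "continuous_on ({0..} \<times> UNIV) D"
    "\<And>t x v. 0 \<le> t \<Longrightarrow> blinfun_apply (D (t, x, v)) (1, fst (vhat (m \<alpha>) v), force \<alpha> (t, x) v) = 0"
proof -
  have "C1_on ({0..} \<times> UNIV) (\<lambda>(t, x, v). f \<alpha> t x v)"
    using solution assms unfolding global_C1_solution_def by blast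
  then obtain D where D: "\<And>z. z \<in> {0..} \<times> UNIV \<Longrightarrow>
       ((\<lambda>(t, x, v). f \<alpha> t x v) has_derivative blinfun_apply (D z)) (at z within {0..} \<times> UNIV)"
    "continuous_on ({0..} \<times> UNIV) D"
    unfolding C1_on_def by blast
  have "blinfun_apply (D (t, x, v)) (1, fst (vhat (m \<alpha>) v), force \<alpha> (t, x) v) = 0"
    if "0 \<le> t" for t x v
  proof -
    obtain v1 v2 where v: "v = (v1, v2)" by (cases v)
    let ?D = "blinfun_apply (D (t, x, v1, v2))"
    have Dz: "((\<lambda>(t, x, v). f \<alpha> t x v) has_derivative ?D) (at (t, x, v1, v2) within {0..} \<times> UNIV)"
      using D(1) that by auto
    have "((\<lambda>s. (s, x, v1, v2)) has_vector_derivative (1, 0, 0, 0)) (at t within {0..})"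
      by (auto simp: has_vector_derivative_def zero_prod_def intro!: derivative_eq_intros)
    from has_real_derivative_along_curve[where p = "\<lambda>s. (s, x, v1, v2)", OF Dz this]
    have t: "time_deriv (\<lambda>s. f \<alpha> s x (v1, v2)) t = ?D (1, 0, 0, 0)"
      using that
      by (intro time_deriv_eq) (auto simp flip: has_real_derivative_iff_has_vector_derivative)
    have "((\<lambda>y. (t, y, v1, v2)) has_vector_derivative (0, 1, 0, 0)) (at x)"
      by (auto simp: has_vector_derivative_def zero_prod_def intro!: derivative_eq_intros)
    from has_real_derivative_along_curve[where p = "\<lambda>y. (t, y, v1, v2)", OF Dz this]
    have x: "deriv (\<lambda>y. f \<alpha> t y (v1, v2)) x = ?D (0, 1, 0, 0)"
      using that by (intro DERIV_imp_deriv) auto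
    have "((\<lambda>w. (t, x, w, v2)) has_vector_derivative (0, 0, 1, 0)) (at v1)"
      by (auto simp: has_vector_derivative_def zero_prod_def intro!: derivative_eq_intros)
    from has_real_derivative_along_curve[where p = "\<lambda>w. (t, x, w, v2)", OF Dz this]
    have v1: "deriv (\<lambda>w. f \<alpha> t x (w, v2)) v1 = ?D (0, 0, 1, 0)"
      using that by (intro DERIV_imp_deriv) auto
    have "((\<lambda>w. (t, x, v1, w)) has_vector_derivative (0, 0, 0, 1)) (at v2)"
      by (auto simp: has_vector_derivative_def zero_prod_def intro!: derivative_eq_intros)
    from has_real_derivative_along_curve[where p = "\<lambda>w. (t, x, v1, w)", OF Dz this]
    have v2: "deriv (\<lambda>w. f \<alpha> t x (v1, w)) v2 = ?D (0, 0, 0, 1)"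
      using that by (intro DERIV_imp_deriv) auto
    define a b c where "a = fst (vhat (m \<alpha>) v)" "b = fst (force \<alpha> (t, x) v)" "c = snd (force \<alpha> (t, x) v)"
    have "?D (1, 0, 0, 0) + a * ?D (0, 1, 0, 0) + b * ?D (0, 0, 1, 0) + c * ?D (0, 0, 0, 1) = 0"
    proof -
      have "time_deriv (\<lambda>s. f \<alpha> s x (v1, v2)) t
        + fst (vhat (m \<alpha>) (v1, v2)) * deriv (\<lambda>y. f \<alpha> t y (v1, v2)) x
        + e \<alpha> * (E1 t x + snd (vhat (m \<alpha>) (v1, v2)) * B t x) * deriv (\<lambda>w. f \<alpha> t x (w, v2)) v1
        + e \<alpha> * (E2 t x - fst (vhat (m \<alpha>) (v1, v2)) * B t x) * deriv (\<lambda>w. f \<alpha> t x (v1, w)) v2 = 0"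
        using solution assms that unfolding global_C1_solution_def by blast
      then show ?thesis
        unfolding t x v1 v2 by (simp add: a_b_c_def force_def v)
    qed
    moreover have "(1 :: real, fst (vhat (m \<alpha>) v), force \<alpha> (t, x) v)
        = (1, 0, 0, 0) + a *\<^sub>R (0, 1, 0, 0) + b *\<^sub>R (0, 0, 1, 0) + c *\<^sub>R (0, 0, 0, 1)"
      by (simp add: a_b_c_def)
    moreover have "?D ((1, 0, 0, 0) + a *\<^sub>R (0, 1, 0, 0) + b *\<^sub>R (0, 0, 1, 0) + c *\<^sub>R (0, 0, 0, 1))
        = ?D (1, 0, 0, 0) + a * ?D (0, 1, 0, 0) + b * ?D (0, 0, 1, 0) + c * ?D (0, 0, 0, 1)"
      by (simp only: blinfun.add_right blinfun.scaleR_right real_scaleR_def)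
    ultimately show ?thesis
      by (simp only: v)
  qed
  with D show ?thesis by (rule that)
qed

lemma continuous_on_f: "\<alpha> \<in> {1..N} \<Longrightarrow> continuous_on ({0..} \<times> UNIV) (\<lambda>(t, x, v). f \<alpha> t x v)"
  by (rule vlasov_derivative, assumption) (rule has_derivative_continuous_on)

lemma continuous_on_fields:
  "continuous_on ({0..} \<times> UNIV) (\<lambda>z. E1 (fst z) (snd z))"
  "continuous_on ({0..} \<times> UNIV) (\<lambda>z. E2 (fst z) (snd z))"
  "continuous_on ({0..} \<times> UNIV) (\<lambda>z. B (fst z) (snd z))"
proof -
  have "continuous_on S g" if C1: "C1_on S g" for S :: "(real \<times> real) set" and g
  proof -
    obtain g' :: "real \<times> real \<Rightarrow> (real \<times> real) \<Rightarrow>\<^sub>L real"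
      where "\<And>z. z \<in> S \<Longrightarrow> (g has_derivative blinfun_apply (g' z)) (at z within S)"
      using C1 unfolding C1_on_def by blast
    then show ?thesis by (rule has_derivative_continuous_on)
  qed
  with solution show "continuous_on ({0..} \<times> UNIV) (\<lambda>z. E1 (fst z) (snd z))"
    "continuous_on ({0..} \<times> UNIV) (\<lambda>z. E2 (fst z) (snd z))"
    "continuous_on ({0..} \<times> UNIV) (\<lambda>z. B (fst z) (snd z))"
    unfolding global_C1_solution_def case_prod_beta' by blast+
qed

section \<open>Support and sign of the densities\<close>

lemma force_bounded:
  obtains K where "0 \<le> K"
    "\<And>\<alpha> \<tau> y w. \<alpha> \<in> {1..N} \<Longrightarrow> \<tau> \<in> {0..T} \<Longrightarrow> \<bar>y\<bar> \<le> L \<Longrightarrow> norm (force \<alpha> (\<tau>, y) w) \<le> K"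
proof -
  define S :: "(real \<times> real) set" where "S = {0..T} \<times> {-L..L}"
  have bounded: "\<exists>M\<ge>0. \<forall>z\<in>S. \<bar>g z\<bar> \<le> M"
    if g: "continuous_on ({0..} \<times> UNIV) g" for g :: "real \<times> real \<Rightarrow> real"
  proof -
    have "compact (g ` S)"
      unfolding S_def
      by (intro compact_continuous_image continuous_on_subset[OF g] compact_Times) auto
    then obtain M where "\<forall>z\<in>S. \<bar>g z\<bar> \<le> M"
      by (auto simp: bounded_iff dest!: compact_imp_bounded)
    then show ?thesis
      by (intro exI[of _ "max M 0"]) (auto simp: le_max_iff_disj)
  qed
  obtain M1 M2 M3 where M: "0 \<le> M1" "0 \<le> M2" "0 \<le> M3" "\<And>z. z \<in> S \<Longrightarrow> \<bar>E1 (fst z) (snd z)\<bar> \<le> M1"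
    "\<And>z. z \<in> S \<Longrightarrow> \<bar>E2 (fst z) (snd z)\<bar> \<le> M2" "\<And>z. z \<in> S \<Longrightarrow> \<bar>B (fst z) (snd z)\<bar> \<le> M3"
    using continuous_on_fields[THEN bounded] by metis
  define K where "K = (\<Sum>\<alpha>=1..N. \<bar>e \<alpha>\<bar>) * (M1 + M2 + 2 * M3)"
  show ?thesis
  proof (rule that)
    show "0 \<le> K" using M by (auto simp: K_def intro!: mult_nonneg_nonneg sum_nonneg)
    fix \<alpha> \<tau> y w assume \<alpha>: "\<alpha> \<in> {1..N}" and "\<tau> \<in> {0..T}" "\<bar>y\<bar> \<le> L"
    then have S: "(\<tau>, y) \<in> S" by (auto simp: S_def)
    have vB: "\<bar>u * B \<tau> y\<bar> \<le> M3" if "\<bar>u\<bar> \<le> 1" for u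
      using mult_mono[OF that M(6)[OF S]] by (simp add: abs_mult)
    have "norm (force \<alpha> (\<tau>, y) w) \<le> \<bar>e \<alpha>\<bar> * \<bar>E1 \<tau> y + snd (vhat (m \<alpha>) w) * B \<tau> y\<bar>
        + \<bar>e \<alpha>\<bar> * \<bar>E2 \<tau> y - fst (vhat (m \<alpha>) w) * B \<tau> y\<bar>"
      unfolding force_def by (rule order_trans[OF norm_Pair_le]) (simp add: abs_mult)
    also have "\<dots> = \<bar>e \<alpha>\<bar> * (\<bar>E1 \<tau> y + snd (vhat (m \<alpha>) w) * B \<tau> y\<bar>
        + \<bar>E2 \<tau> y - fst (vhat (m \<alpha>) w) * B \<tau> y\<bar>)"
      by (simp add: algebra_simps)
    also have "\<dots> \<le> (\<Sum>\<alpha>=1..N. \<bar>e \<alpha>\<bar>) * (M1 + M2 + 2 * M3)"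
    proof (rule mult_mono)
      show "\<bar>e \<alpha>\<bar> \<le> (\<Sum>\<alpha>=1..N. \<bar>e \<alpha>\<bar>)"
        using \<alpha> by (intro member_le_sum) auto
      show "\<bar>E1 \<tau> y + snd (vhat (m \<alpha>) w) * B \<tau> y\<bar> + \<bar>E2 \<tau> y - fst (vhat (m \<alpha>) w) * B \<tau> y\<bar>
          \<le> M1 + M2 + 2 * M3"
        using M(4,5)[OF S, unfolded fst_conv snd_conv] vB[OF abs_vhat_le_1(1)[OF mass_pos[OF \<alpha>], of w]]
          vB[OF abs_vhat_le_1(2)[OF mass_pos[OF \<alpha>], of w]]
        by linarith
    qed (auto intro: sum_nonneg)
    finally show "norm (force \<alpha> (\<tau>, y) w) \<le> K" by (simp add: K_def)
  qed
qed

text \<open>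
The set of \<open>(\<tau>, y, w)\<close> with \<open>\<bar>y - x\<bar> \<le> t - \<tau>\<close> and \<open>\<bar>w - v\<bar> \<le> K (t - \<tau>)\<close> is compact and is not left by moving
backward in time with \<open>x\<close>-speed at most 1 and force at most \<open>K\<close>. So the maximum principle applies on it.
The factor \<open>c\<close> allows both upper and lower bounds of \<open>f \<alpha>\<close>.
\<close>
lemma domain_of_dependence:
  assumes "\<alpha> \<in> {1..N}" "0 \<le> t" "0 \<le> K"
    and K: "\<And>\<tau> y w. \<tau> \<in> {0..t} \<Longrightarrow> \<bar>y - x\<bar> \<le> t - \<tau> \<Longrightarrow> norm (force \<alpha> (\<tau>, y) w) \<le> K"
    and init: "\<And>y w. \<bar>y - x\<bar> \<le> t \<Longrightarrow> norm (w - v) \<le> K * t \<Longrightarrow> c * f0 \<alpha> y w \<le> 0"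
  shows "c * f \<alpha> t x v \<le> 0"
proof -
  obtain D where D: "\<And>z. z \<in> {0..} \<times> UNIV \<Longrightarrow>
       ((\<lambda>(t, x, v). f \<alpha> t x v) has_derivative blinfun_apply (D z)) (at z within {0..} \<times> UNIV)"
    "\<And>t x v. 0 \<le> t \<Longrightarrow> blinfun_apply (D (t, x, v)) (1, fst (vhat (m \<alpha>) v), force \<alpha> (t, x) v) = 0"
    using vlasov_derivative[OF assms(1)] by metis
  define S where "S = {z :: real \<times> real \<times> real \<times> real. 0 \<le> fst z \<and> fst z \<le> t \<and>
      \<bar>fst (snd z) - x\<bar> \<le> t - fst z \<and> norm (snd (snd z) - v) \<le> K * (t - fst z)}"
  have "compact S"
  proof -
    have "closed S"
      unfolding S_def by (intro closed_Collect_conj closed_Collect_le continuous_intros)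
    moreover have "S \<subseteq> {0..t} \<times> cball x t \<times> cball v (K * t)"
    proof
      fix z assume z: "z \<in> S"
      have "K * (t - fst z) \<le> K * t"
        using z \<open>0 \<le> K\<close> by (intro mult_left_mono) (auto simp: S_def)
      then show "z \<in> {0..t} \<times> cball x t \<times> cball v (K * t)"
        using z by (auto simp: S_def mem_Times_iff dist_norm norm_minus_commute)
    qed
    moreover have "compact ({0..t} \<times> cball x t \<times> cball v (K * t))"
      by (intro compact_Times) auto
    ultimately show ?thesis
      using bounded_subset[OF compact_imp_bounded, of "{0..t} \<times> cball x t \<times> cball v (K * t)" S]
      by (simp add: compact_eq_bounded_closed)
  qed
  have "c * (\<lambda>(t, x, v). f \<alpha> t x v) (t, x, v) \<le> 0"
  proof (rule transport_max_principle[where S = S and G = "\<lambda>z h. c * blinfun_apply (D z) h"])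
    show "compact S" by fact
    show "(t, x, v) \<in> S" using assms(2) by (simp add: S_def)
    fix z assume z: "z \<in> S"
    obtain \<tau> y w where zeq: "z = (\<tau>, y, w)" by (cases z)
    have \<tau>: "0 \<le> \<tau>" "\<tau> \<le> t" "\<bar>y - x\<bar> \<le> t - \<tau>" "norm (w - v) \<le> K * (t - \<tau>)"
      using z by (auto simp: S_def zeq)
    show "0 \<le> fst z" using \<tau> by (simp add: zeq)
    show "((\<lambda>z. c * (\<lambda>(t, x, v). f \<alpha> t x v) z) has_derivative (\<lambda>h. c * blinfun_apply (D z) h))
        (at z within {0..} \<times> UNIV)"
      using D(1)[of z] \<tau>(1) by (intro has_derivative_mult_right) (simp add: zeq)
    show "c * (\<lambda>(t, x, v). f \<alpha> t x v) z \<le> 0" if "fst z = 0"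
      using that \<tau> init[of y w] initial_values(1)[OF assms(1)] by (simp add: zeq)
    define a b where "a = fst (vhat (m \<alpha>) w)" "b = force \<alpha> (\<tau>, y) w"
    have "z - s *\<^sub>R (1, a, b) \<in> S" if s: "s \<in> {0..fst z}" for s
    proof -
      have "\<bar>y - s * a - x\<bar> \<le> \<bar>y - x\<bar> + s * \<bar>a\<bar>"
        using s abs_triangle_ineq4[of "y - x" "s * a"] by (simp add: abs_mult algebra_simps)
      also have "\<dots> \<le> (t - \<tau>) + s * 1"
        using s \<tau> abs_vhat_le_1(1)[OF mass_pos[OF assms(1)], of w]
        by (intro add_mono mult_left_mono) (auto simp: a_b_def)
      finally have x: "\<bar>y - s * a - x\<bar> \<le> t - (\<tau> - s)" by simp
      have "norm (w - s *\<^sub>R b - v) \<le> norm (w - v) + s * norm b"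
        using s norm_triangle_ineq4[of "w - v" "s *\<^sub>R b"] by (simp add: algebra_simps)
      also have "\<dots> \<le> K * (t - \<tau>) + s * K"
        using s \<tau> K[of \<tau> y w] by (intro add_mono mult_left_mono) (auto simp: a_b_def)
      finally have "norm (w - s *\<^sub>R b - v) \<le> K * (t - (\<tau> - s))"
        by (simp add: algebra_simps)
      with x show ?thesis
        using s \<tau> by (simp add: S_def zeq)
    qed
    moreover have "c * blinfun_apply (D z) (1, a, b) = 0"
      using D(2)[OF \<tau>(1), of y w] by (simp add: zeq a_b_def)
    ultimately show "\<exists>d. c * blinfun_apply (D z) (1, d) = 0 \<and> (\<forall>s\<in>{0..fst z}. z - s *\<^sub>R (1, d) \<in> S)"
      by (intro exI[of _ "(a, b)"]) auto
  qed
  then show ?thesis by simp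
qed

lemma force_bounded_on_cone:
  obtains K where "0 \<le> K"
    "\<And>\<alpha> \<tau> y w. \<alpha> \<in> {1..N} \<Longrightarrow> \<tau> \<in> {0..t} \<Longrightarrow> \<bar>y - x\<bar> \<le> t - \<tau> \<Longrightarrow> norm (force \<alpha> (\<tau>, y) w) \<le> K"
proof -
  obtain K where K: "0 \<le> K" "\<And>\<alpha> \<tau> y w. \<alpha> \<in> {1..N} \<Longrightarrow> \<tau> \<in> {0..t} \<Longrightarrow> \<bar>y\<bar> \<le> \<bar>x\<bar> + t \<Longrightarrow>
      norm (force \<alpha> (\<tau>, y) w) \<le> K"
    using force_bounded[of t "\<bar>x\<bar> + t"] by metis
  show ?thesis
    by (rule that[OF K(1)], rule K(2)) auto
qed

lemma f_nonneg:
  assumes "\<alpha> \<in> {1..N}" "0 \<le> t"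
  shows "0 \<le> f \<alpha> t x v"
proof -
  obtain K where "0 \<le> K"
    "\<And>\<tau> y w. \<tau> \<in> {0..t} \<Longrightarrow> \<bar>y - x\<bar> \<le> t - \<tau> \<Longrightarrow> norm (force \<alpha> (\<tau>, y) w) \<le> K"
    using force_bounded_on_cone[of t x] assms(1) by metis
  then have "- 1 * f \<alpha> t x v \<le> 0"
    using data assms by (intro domain_of_dependence) (auto simp: admissible_data_def)
  then show ?thesis by simp
qed

lemma f_eq_0_outside_light_cone:
  assumes "\<alpha> \<in> {1..N}" "0 \<le> t" "C0 + t \<le> \<bar>x\<bar>"
  shows "f \<alpha> t x v = 0"
proof -
  obtain K where "0 \<le> K"
    "\<And>\<tau> y w. \<tau> \<in> {0..t} \<Longrightarrow> \<bar>y - x\<bar> \<le> t - \<tau> \<Longrightarrow> norm (force \<alpha> (\<tau>, y) w) \<le> K"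
    using force_bounded_on_cone[of t x] assms(1) by metis
  moreover have "f0 \<alpha> y w = 0" if "\<bar>y - x\<bar> \<le> t" for y w
  proof -
    have "C0 \<le> \<bar>y\<bar>" using assms that by linarith
    then show ?thesis
      using vanish assms(1) unfolding data_vanish_outside_def by blast
  qed
  ultimately have "1 * f \<alpha> t x v \<le> 0"
    using assms by (intro domain_of_dependence) auto
  with f_nonneg[OF assms(1,2)] show ?thesis
    by (simp add: order_antisym)
qed

text \<open>
Only \<open>\<bar>x\<bar> < C0 + t\<close> matters, and the cones below such points stay within \<open>\<bar>y\<bar> \<le> C0 + 2 T\<close>, where the
force has a bound \<open>K\<close>. In time \<open>T\<close> it changes momenta by at most \<open>K T\<close>.
\<close>
lemma f_momentum_support:
  assumes "0 \<le> T"
  obtains R where "0 < R"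
    "\<forall>\<alpha>\<in>{1..N}. \<forall>t\<in>{0..T}. \<forall>x v. R \<le> norm v \<longrightarrow> f \<alpha> t x v = 0"
proof -
  have "\<exists>r. \<forall>y w. f0 \<alpha> y w \<noteq> 0 \<longrightarrow> norm w \<le> r" if "\<alpha> \<in> {1..N}" for \<alpha>
  proof -
    have "compact (closure {z. (\<lambda>(x, v). f0 \<alpha> x v) z \<noteq> 0})"
      using data that unfolding admissible_data_def compactly_supported_def by blast
    then have "bounded {z. (\<lambda>(x, v). f0 \<alpha> x v) z \<noteq> 0}"
      using bounded_subset[OF compact_imp_bounded closure_subset] by blast
    then obtain r where r: "\<And>y w. f0 \<alpha> y w \<noteq> 0 \<Longrightarrow> norm (y, w) \<le> r"
      by (auto simp: bounded_iff)
    have "norm w \<le> r" if "f0 \<alpha> y w \<noteq> 0" for y w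
      using order_trans[OF norm_snd_le r[OF that]] .
    then show ?thesis by blast
  qed
  then obtain r where r: "\<And>\<alpha> y w. \<alpha> \<in> {1..N} \<Longrightarrow> f0 \<alpha> y w \<noteq> 0 \<Longrightarrow> norm w \<le> r \<alpha>"
    by metis
  define R0 where "R0 = (\<Sum>\<alpha>=1..N. \<bar>r \<alpha>\<bar>)"
  have R0: "norm w \<le> R0" if "\<alpha> \<in> {1..N}" "f0 \<alpha> y w \<noteq> 0" for \<alpha> y w
  proof -
    have "norm w \<le> \<bar>r \<alpha>\<bar>" using r[OF that] by simp
    also have "\<dots> \<le> R0" unfolding R0_def using that by (intro member_le_sum) auto
    finally show ?thesis .
  qed
  have "0 \<le> R0" by (auto simp: R0_def intro: sum_nonneg)
  obtain K where K: "0 \<le> K" "\<And>\<alpha> \<tau> y w. \<alpha> \<in> {1..N} \<Longrightarrow> \<tau> \<in> {0..T} \<Longrightarrow> \<bar>y\<bar> \<le> C0 + 2 * T \<Longrightarrow>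
      norm (force \<alpha> (\<tau>, y) w) \<le> K"
    using force_bounded[of T "C0 + 2 * T"] by metis
  show ?thesis
  proof (rule that[of "R0 + K * T + 1"])
    show "0 < R0 + K * T + 1"
      using \<open>0 \<le> R0\<close> \<open>0 \<le> K\<close> assms by (simp add: add_nonneg_pos)
    have "f \<alpha> t x v = 0" if \<alpha>: "\<alpha> \<in> {1..N}" and t: "t \<in> {0..T}" and v: "R0 + K * T + 1 \<le> norm v"
      for \<alpha> t x and v :: "real \<times> real"
    proof (cases "C0 + t \<le> \<bar>x\<bar>")
      case True
      then show ?thesis using f_eq_0_outside_light_cone \<alpha> t by simp
    next
      case False
      have "f0 \<alpha> y w = 0" if "norm (w - v) \<le> K * t" for y and w :: "real \<times> real"
      proof (rule ccontr)
        assume "f0 \<alpha> y w \<noteq> 0"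
        moreover have "K * t \<le> K * T"
          using t \<open>0 \<le> K\<close> by (intro mult_left_mono) auto
        moreover have "norm v \<le> norm w + norm (w - v)"
          by (metis norm_minus_commute norm_triangle_sub)
        ultimately show False
          using R0[OF \<alpha>, of y w] that v by linarith
      qed
      then have "1 * f \<alpha> t x v \<le> 0"
        using \<alpha> t False by (intro domain_of_dependence[OF _ _ K(1)] K(2)) auto
      then show ?thesis
        using f_nonneg[OF \<alpha>, of t x v] t by simp
    qed
    then show "\<forall>\<alpha>\<in>{1..N}. \<forall>t\<in>{0..T}. \<forall>x v. R0 + K * T + 1 \<le> norm v \<longrightarrow> f \<alpha> t x v = 0"
      by blast
  qed
qed

section \<open>Momentum moments of one species\<close>

definition moment :: "nat \<Rightarrow> (real \<times> real \<Rightarrow> real) \<Rightarrow> real \<times> real \<Rightarrow> real" where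
  "moment \<alpha> w z = (LINT v|lborel. w v * f \<alpha> (fst z) (snd z) v)"

lemma continuous_on_f_momentum:
  assumes "\<alpha> \<in> {1..N}" "0 \<le> t"
  shows "continuous_on UNIV (f \<alpha> t x)"
proof -
  have "continuous_on UNIV (\<lambda>v. (\<lambda>(t, x, v). f \<alpha> t x v) (t, x, v))"
    by (rule continuous_on_compose2[OF continuous_on_f[OF assms(1)]])
      (use assms(2) in \<open>auto intro!: continuous_intros\<close>)
  then show ?thesis by simp
qed

lemma moment_integral_box:
  assumes R: "\<forall>\<alpha>\<in>{1..N}. \<forall>t\<in>{0..T}. \<forall>x v. R \<le> norm v \<longrightarrow> f \<alpha> t x v = 0"
    and \<alpha>: "\<alpha> \<in> {1..N}" and z: "z \<in> strip T" and w: "continuous_on UNIV w"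
  shows "integrable lborel (\<lambda>v. w v * f \<alpha> (fst z) (snd z) v)"
    and "moment \<alpha> w z = integral (cbox (-R, -R) (R, R)) (\<lambda>v. w v * f \<alpha> (fst z) (snd z) v)"
proof -
  have "continuous_on UNIV (\<lambda>v. w v * f \<alpha> (fst z) (snd z) v)"
    using z by (intro continuous_intros w continuous_on_f_momentum[OF \<alpha>]) auto
  then have cont: "continuous_on (cbox (-R, -R) (R, R)) (\<lambda>v. w v * f \<alpha> (fst z) (snd z) v)"
    using continuous_on_subset by blast
  have zero: "w v * f \<alpha> (fst z) (snd z) v = 0" if "v \<notin> cbox (-R, -R) (R, R)" for v
  proof -
    have "R \<le> \<bar>fst v\<bar> \<or> R \<le> \<bar>snd v\<bar>"
      using that by (cases v) (auto simp: cbox_Pair_eq abs_if)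
    then have "R \<le> norm v"
      using norm_fst_le[of "fst v" "snd v"] norm_snd_le[of "snd v" "fst v"] by auto
    moreover have "fst z \<in> {0..T}"
      using z by auto
    ultimately have "f \<alpha> (fst z) (snd z) v = 0"
      using R \<alpha> by blast
    then show ?thesis
      by simp
  qed
  show "integrable lborel (\<lambda>v. w v * f \<alpha> (fst z) (snd z) v)"
    and "moment \<alpha> w z = integral (cbox (-R, -R) (R, R)) (\<lambda>v. w v * f \<alpha> (fst z) (snd z) v)"
    unfolding moment_def using lebesgue_integral_eq_box[OF cont zero] by auto
qed

lemma integrable_moment:
  assumes "\<alpha> \<in> {1..N}" "0 \<le> t" "continuous_on UNIV w"
  shows "integrable lborel (\<lambda>v. w v * f \<alpha> t x v)"
proof -
  obtain R where "\<forall>\<alpha>\<in>{1..N}. \<forall>s\<in>{0..t}. \<forall>x v. R \<le> norm v \<longrightarrow> f \<alpha> s x v = 0"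
    using f_momentum_support[OF assms(2)] by metis
  from moment_integral_box(1)[OF this assms(1) _ assms(3), where z = "(t, x)"] assms(2) show ?thesis
    by auto
qed

lemma moment_linear:
  assumes "\<alpha> \<in> {1..N}" "0 \<le> t" "continuous_on UNIV w" "continuous_on UNIV u"
  shows "moment \<alpha> (\<lambda>v. a * w v + b * u v) (t, x) = a * moment \<alpha> w (t, x) + b * moment \<alpha> u (t, x)"
proof -
  have "moment \<alpha> (\<lambda>v. a * w v + b * u v) (t, x)
      = (LINT v|lborel. a * (w v * f \<alpha> t x v) + b * (u v * f \<alpha> t x v))"
    by (simp add: moment_def algebra_simps)
  also have "\<dots> = a * moment \<alpha> w (t, x) + b * moment \<alpha> u (t, x)"
    using integrable_moment[OF assms(1,2)] assms(3,4) by (simp add: moment_def)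
  finally show ?thesis .
qed

lemma moment_nonneg:
  "\<alpha> \<in> {1..N} \<Longrightarrow> 0 \<le> t \<Longrightarrow> (\<And>v. 0 \<le> w v) \<Longrightarrow> 0 \<le> moment \<alpha> w (t, x)"
  by (simp add: moment_def f_nonneg Bochner_Integration.integral_nonneg)

lemma moment_eq_0_outside_light_cone:
  "\<alpha> \<in> {1..N} \<Longrightarrow> 0 \<le> t \<Longrightarrow> C0 + t \<le> \<bar>x\<bar> \<Longrightarrow> moment \<alpha> w (t, x) = 0"
  by (simp add: moment_def f_eq_0_outside_light_cone)

text \<open>
The Vlasov equation multiplied by a weight \<open>w\<close> and integrated over momenta. Integration by parts moves
the momentum derivatives from \<open>f \<alpha>\<close> to the weight. The derivatives that fall on the force cancel,
since the force is divergence free in momentum space.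
\<close>
lemma moment_balance:
  assumes \<alpha>: "\<alpha> \<in> {1..N}" and "0 \<le> T"
    and w1: "\<And>x y. ((\<lambda>x. w (x, y)) has_real_derivative w1 (x, y)) (at x)"
    and w2: "\<And>x y. ((\<lambda>y. w (x, y)) has_real_derivative w2 (x, y)) (at y)"
    and cont: "continuous_on UNIV w" "continuous_on UNIV w1" "continuous_on UNIV w2"
  obtains Pt Px Qt Qx where "has_partials_on T (moment \<alpha> w) Pt Px"
    "has_partials_on T (moment \<alpha> (\<lambda>v. fst (vhat (m \<alpha>) v) * w v)) Qt Qx"
    "\<And>z. z \<in> strip T \<Longrightarrow>
       Pt z + Qx z = moment \<alpha> (\<lambda>v. fst (force \<alpha> z v) * w1 v + snd (force \<alpha> z v) * w2 v) z"
proof -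
  obtain D where D: "\<And>z. z \<in> {0..} \<times> UNIV \<Longrightarrow>
       ((\<lambda>(t, x, v). f \<alpha> t x v) has_derivative blinfun_apply (D z)) (at z within {0..} \<times> UNIV)"
    and contD: "continuous_on ({0..} \<times> UNIV) D"
    and Dz: "\<And>t x v. 0 \<le> t \<Longrightarrow> blinfun_apply (D (t, x, v)) (1, fst (vhat (m \<alpha>) v), force \<alpha> (t, x) v) = 0"
    using vlasov_derivative[OF \<alpha>] by metis
  obtain R where "0 < R" and R:
    "\<forall>\<alpha>\<in>{1..N}. \<forall>t\<in>{0..T}. \<forall>x v. R \<le> norm v \<longrightarrow> f \<alpha> t x v = 0"
    using f_momentum_support[OF \<open>0 \<le> T\<close>] by metis
  define box :: "(real \<times> real) set" where "box = cbox (-R, -R) (R, R)"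
  define d where "d h z v = blinfun_apply (D (fst z, snd z, v)) h" for h z v
  have der_t: "((\<lambda>s. f \<alpha> s x v) has_real_derivative d (1, 0) (t, x) v) (at t within {0..T})"
    if "t \<in> {0..T}" for t x v
  proof -
    have "((\<lambda>s. (s, x, v)) has_vector_derivative (1, 0, 0)) (at t within {0..T})"
      by (auto simp: has_vector_derivative_def zero_prod_def intro!: derivative_eq_intros)
    from has_real_derivative_along_curve[where p = "\<lambda>s. (s, x, v)", OF D this] that show ?thesis
      by (auto simp: d_def zero_prod_def)
  qed
  have der_x: "((\<lambda>y. f \<alpha> t y v) has_real_derivative d (0, 1, 0) (t, x) v) (at x)"
    if "t \<in> {0..T}" for t x v
  proof -
    have "((\<lambda>y. (t, y, v)) has_vector_derivative (0, 1, 0)) (at x)"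
      by (auto simp: has_vector_derivative_def zero_prod_def intro!: derivative_eq_intros)
    from has_real_derivative_along_curve[where p = "\<lambda>y. (t, y, v)", OF D this] that show ?thesis
      by (auto simp: d_def)
  qed
  have der_v1: "((\<lambda>a. f \<alpha> t x (a, b)) has_real_derivative d (0, 0, 1, 0) (t, x) (a, b)) (at a)"
    if "t \<in> {0..T}" for t x a b
  proof -
    have "((\<lambda>a. (t, x, a, b)) has_vector_derivative (0, 0, 1, 0)) (at a)"
      by (auto simp: has_vector_derivative_def zero_prod_def intro!: derivative_eq_intros)
    from has_real_derivative_along_curve[where p = "\<lambda>a. (t, x, a, b)", OF D this] that show ?thesis
      by (auto simp: d_def)
  qed
  have der_v2: "((\<lambda>b. f \<alpha> t x (a, b)) has_real_derivative d (0, 0, 0, 1) (t, x) (a, b)) (at b)"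
    if "t \<in> {0..T}" for t x a b
  proof -
    have "((\<lambda>b. (t, x, a, b)) has_vector_derivative (0, 0, 0, 1)) (at b)"
      by (auto simp: has_vector_derivative_def zero_prod_def intro!: derivative_eq_intros)
    from has_real_derivative_along_curve[where p = "\<lambda>b. (t, x, a, b)", OF D this] that show ?thesis
      by (auto simp: d_def)
  qed
  have cont_d: "continuous_on (strip T \<times> box) (\<lambda>p. d h (fst p) (snd p))" for h
    unfolding d_def
    by (intro continuous_intros continuous_on_compose2[OF contD]) auto
  have cont_dv: "continuous_on UNIV (d h z)" if "z \<in> strip T" for h z
    unfolding d_def using that
    by (intro continuous_intros continuous_on_compose2[OF contD]) auto
  have cont_f: "continuous_on (strip T \<times> box) (\<lambda>p. f \<alpha> (fst (fst p)) (snd (fst p)) (snd p))"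
  proof -
    have "continuous_on (strip T \<times> box) (\<lambda>p. (\<lambda>(t, x, v). f \<alpha> t x v) (fst (fst p), snd (fst p), snd p))"
      by (rule continuous_on_compose2[OF continuous_on_f[OF \<alpha>]]) (auto intro!: continuous_intros)
    then show ?thesis by simp
  qed
  have partials: "has_partials_on T (moment \<alpha> u)
      (\<lambda>z. integral box (\<lambda>v. u v * d (1, 0) z v)) (\<lambda>z. integral box (\<lambda>v. u v * d (0, 1, 0) z v))"
    if u: "continuous_on UNIV u" for u
  proof -
    have "continuous_on (strip T \<times> box) (\<lambda>p. u (snd p))"
      by (rule continuous_on_compose2[OF u]) (auto intro!: continuous_intros)
    then have "has_partials_on T (\<lambda>z. integral box (\<lambda>v. u v * f \<alpha> (fst z) (snd z) v))
      (\<lambda>z. integral box (\<lambda>v. u v * d (1, 0) z v)) (\<lambda>z. integral box (\<lambda>v. u v * d (0, 1, 0) z v))"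
      unfolding box_def
      by (intro has_partials_on_box_integral)
        (auto simp: case_prod_beta' box_def[symmetric] simp del: mem_box
          intro!: DERIV_cmult der_t der_x continuous_on_mult cont_d cont_f)
    then show ?thesis
      by (rule has_partials_on_cong)
        (auto simp: moment_integral_box(2)[OF R \<alpha> _ u] box_def)
  qed
  define vh where "vh = (\<lambda>v. fst (vhat (m \<alpha>) v))"
  have cont_vh: "continuous_on UNIV vh"
    unfolding vh_def by (intro continuous_on_vhat mass_pos \<alpha> continuous_on_id)
  have balance: "integral box (\<lambda>v. w v * d (1, 0) z v) + integral box (\<lambda>v. vh v * w v * d (0, 1, 0) z v)
      = moment \<alpha> (\<lambda>v. fst (force \<alpha> z v) * w1 v + snd (force \<alpha> z v) * w2 v) z"
    if z: "z \<in> strip T" for z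
  proof -
    obtain t x where zeq: "z = (t, x)" and t: "t \<in> {0..T}"
      using z by auto
    define F1 F2 g where "F1 = (\<lambda>v. fst (force \<alpha> z v))" "F2 = (\<lambda>v. snd (force \<alpha> z v))" "g = f \<alpha> t x"
    \<comment> \<open>the derivative of \<open>F1\<close> in the first, and minus that of \<open>F2\<close> in the second momentum variable\<close>
    define \<kappa> where "\<kappa> v = e \<alpha> * B t x * (- fst v * snd v / rel_energy (m \<alpha>) v ^ 3)" for v
    have ne: "rel_energy (m \<alpha>) v \<noteq> 0" for v
      using rel_energy_pos[OF mass_pos[OF \<alpha>], of v] by simp
    have cont_F: "continuous_on UNIV F1" "continuous_on UNIV F2" "continuous_on UNIV \<kappa>"
      unfolding F1_F2_g_def force_def \<kappa>_def fst_conv snd_conv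
      by (intro continuous_intros continuous_on_vhat mass_pos \<alpha>; simp add: ne)+
    have cont_g: "continuous_on UNIV g"
      unfolding F1_F2_g_def using continuous_on_f_momentum[OF \<alpha>] t by simp
    have g0: "g v = 0" if "R \<le> norm v" for v
      unfolding F1_F2_g_def using R \<alpha> t that by blast
    have dF1: "((\<lambda>a. F1 (a, b)) has_real_derivative \<kappa> (a, b)) (at a)" for a b
      unfolding F1_F2_g_def force_def fst_conv snd_conv zeq
      by (auto simp: \<kappa>_def intro!: derivative_eq_intros vhat_cross_derivatives mass_pos[OF \<alpha>])
    have dF2: "((\<lambda>b. F2 (a, b)) has_real_derivative - \<kappa> (a, b)) (at b)" for a b
      unfolding F1_F2_g_def force_def fst_conv snd_conv zeq
      by (auto simp: \<kappa>_def intro!: derivative_eq_intros vhat_cross_derivatives mass_pos[OF \<alpha>])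
    have "R \<le> norm (a, b)" if "\<bar>a\<bar> = R \<or> \<bar>b\<bar> = R" for a b :: real
      using that norm_fst_le[of a b] norm_snd_le[of b a] by auto
    then have edge: "g (a, b) = 0" if "\<bar>a\<bar> = R \<or> \<bar>b\<bar> = R" for a b
      using that g0 by blast
    \<comment> \<open>the momentum derivatives of \<open>w F1 f\<close> and \<open>w F2 f\<close>, whose integrals over the box vanish\<close>
    define H1 where "H1 v = w1 v * F1 v * g v + w v * \<kappa> v * g v + w v * F1 v * d (0, 0, 1, 0) z v" for v
    define H2 where "H2 v = w2 v * F2 v * g v - w v * \<kappa> v * g v + w v * F2 v * d (0, 0, 0, 1) z v" for v
    note conts = cont cont_F cont_g cont_vh cont_dv[OF z]
    have cont_H: "continuous_on UNIV H1" "continuous_on UNIV H2"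
      unfolding H1_def H2_def by (intro continuous_intros conts)+
    have "integral box H1 = 0"
      unfolding box_def
    proof (rule integral_partial_derivative_fst_eq_0[where h = "\<lambda>v. w v * F1 v * g v"])
      show "((\<lambda>a. w (a, b) * F1 (a, b) * g (a, b)) has_real_derivative H1 (a, b)) (at a)" for a b
        using der_v1[OF t, of x b a] w1[of b a] dF1[of b a]
        by (auto simp: H1_def F1_F2_g_def(3) zeq algebra_simps intro!: derivative_eq_intros)
    qed (use cont_H \<open>0 < R\<close> in \<open>auto simp: edge\<close>)
    moreover have "integral box H2 = 0"
      unfolding box_def
    proof (rule integral_partial_derivative_snd_eq_0[where h = "\<lambda>v. w v * F2 v * g v"])
      show "((\<lambda>b. w (a, b) * F2 (a, b) * g (a, b)) has_real_derivative H2 (a, b)) (at b)" for a b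
        using der_v2[OF t, of x a b] w2[of a b] dF2[of a b]
        by (auto simp: H2_def F1_F2_g_def(3) zeq algebra_simps intro!: derivative_eq_intros)
    qed (use cont_H \<open>0 < R\<close> in \<open>auto simp: edge\<close>)
    moreover have int: "h integrable_on box" if "continuous_on UNIV h" for h :: "real \<times> real \<Rightarrow> real"
      unfolding box_def using that continuous_on_subset by (intro integrable_continuous) blast
    moreover have "w v * d (1, 0) z v + vh v * w v * d (0, 1, 0) z v
        = (F1 v * w1 v + F2 v * w2 v) * g v - (H1 v + H2 v)" for v
    proof -
      have "(1 :: real, vh v, F1 v, F2 v) = (1, 0) + vh v *\<^sub>R (0, 1, 0) + F1 v *\<^sub>R (0, 0, 1, 0) + F2 v *\<^sub>R (0, 0, 0, 1)"
        by (simp add: zero_prod_def)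
      moreover have "d (1, vh v, F1 v, F2 v) z v = 0"
        using Dz[of t x v] t by (simp add: d_def zeq vh_def F1_F2_g_def)
      ultimately have "d (1, 0) z v + vh v * d (0, 1, 0) z v + F1 v * d (0, 0, 1, 0) z v
          + F2 v * d (0, 0, 0, 1) z v = 0"
        by (simp only: d_def blinfun.add_right blinfun.scaleR_right real_scaleR_def)
      then have "w v * (d (1, 0) z v + vh v * d (0, 1, 0) z v + F1 v * d (0, 0, 1, 0) z v
          + F2 v * d (0, 0, 0, 1) z v) = 0"
        by simp
      then show ?thesis
        by (simp add: H1_def H2_def algebra_simps)
    qed
    moreover have "integral box (\<lambda>v. w v * d (1, 0) z v) + integral box (\<lambda>v. vh v * w v * d (0, 1, 0) z v)
        = integral box (\<lambda>v. w v * d (1, 0) z v + vh v * w v * d (0, 1, 0) z v)"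
      by (intro Henstock_Kurzweil_Integration.integral_add[symmetric] int continuous_intros conts)
    moreover have "integral box (\<lambda>v. (F1 v * w1 v + F2 v * w2 v) * g v - (H1 v + H2 v))
        = integral box (\<lambda>v. (F1 v * w1 v + F2 v * w2 v) * g v) - (integral box H1 + integral box H2)"
      unfolding Henstock_Kurzweil_Integration.integral_add[OF cont_H[THEN int], symmetric]
      by (intro Henstock_Kurzweil_Integration.integral_diff int continuous_intros conts cont_H)
    moreover have "moment \<alpha> (\<lambda>v. F1 v * w1 v + F2 v * w2 v) z
        = integral box (\<lambda>v. (F1 v * w1 v + F2 v * w2 v) * g v)"
      by (subst moment_integral_box(2)[OF R \<alpha> z])
        (auto intro!: continuous_intros conts simp: box_def F1_F2_g_def(3) zeq)
    ultimately show ?thesis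
      by (simp add: F1_F2_g_def(1,2))
  qed
  show ?thesis
  proof (rule that)
    show "has_partials_on T (moment \<alpha> w)
      (\<lambda>z. integral box (\<lambda>v. w v * d (1, 0) z v)) (\<lambda>z. integral box (\<lambda>v. w v * d (0, 1, 0) z v))"
      by (rule partials[OF cont(1)])
    show "has_partials_on T (moment \<alpha> (\<lambda>v. fst (vhat (m \<alpha>) v) * w v))
      (\<lambda>z. integral box (\<lambda>v. vh v * w v * d (1, 0) z v))
      (\<lambda>z. integral box (\<lambda>v. vh v * w v * d (0, 1, 0) z v))"
      using partials[of "\<lambda>v. vh v * w v"] cont(1) cont_vh
      by (simp add: vh_def continuous_on_mult)
  qed (rule balance)
qed

section \<open>Sums over the species\<close>

definition total :: "(nat \<Rightarrow> real \<times> real \<Rightarrow> real) \<Rightarrow> real \<times> real \<Rightarrow> real" where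
  "total w z = (\<Sum>\<alpha>=1..N. moment \<alpha> (w \<alpha>) z)"

lemma total_cong: "(\<And>\<alpha> v. \<alpha> \<in> {1..N} \<Longrightarrow> w \<alpha> v = u \<alpha> v) \<Longrightarrow> total w z = total u z"
  unfolding total_def moment_def by (intro sum.cong refl) simp

lemma total_linear:
  assumes "0 \<le> t" "\<And>\<alpha>. \<alpha> \<in> {1..N} \<Longrightarrow> continuous_on UNIV (w \<alpha>)"
    "\<And>\<alpha>. \<alpha> \<in> {1..N} \<Longrightarrow> continuous_on UNIV (u \<alpha>)"
  shows "total (\<lambda>\<alpha> v. a * w \<alpha> v + b * u \<alpha> v) (t, x) = a * total w (t, x) + b * total u (t, x)"
  unfolding total_def by (simp add: moment_linear assms sum.distrib sum_distrib_left)

lemma total_nonneg: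
  "0 \<le> t \<Longrightarrow> (\<And>\<alpha> v. \<alpha> \<in> {1..N} \<Longrightarrow> 0 \<le> w \<alpha> v) \<Longrightarrow> 0 \<le> total w (t, x)"
  unfolding total_def by (intro sum_nonneg moment_nonneg) auto

lemma total_eq_0_outside_light_cone:
  "0 \<le> t \<Longrightarrow> C0 + t \<le> \<bar>x\<bar> \<Longrightarrow> total w (t, x) = 0"
  unfolding total_def by (simp add: moment_eq_0_outside_light_cone)

lemma integral_sum_eq_total:
  assumes "0 \<le> t" "\<And>\<alpha>. \<alpha> \<in> {1..N} \<Longrightarrow> continuous_on UNIV (w \<alpha>)"
  shows "(LINT v|lborel. (\<Sum>\<alpha>=1..N. w \<alpha> v * f \<alpha> t x v)) = total w (t, x)"
  unfolding total_def moment_def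
  using integrable_moment[OF _ assms(1)] assms(2) by (subst Bochner_Integration.integral_sum) auto

lemma total_balance:
  assumes "0 \<le> T"
    and w1: "\<And>\<alpha> x y. \<alpha> \<in> {1..N} \<Longrightarrow> ((\<lambda>x. w \<alpha> (x, y)) has_real_derivative w1 \<alpha> (x, y)) (at x)"
    and w2: "\<And>\<alpha> x y. \<alpha> \<in> {1..N} \<Longrightarrow> ((\<lambda>y. w \<alpha> (x, y)) has_real_derivative w2 \<alpha> (x, y)) (at y)"
    and cont: "\<And>\<alpha>. \<alpha> \<in> {1..N} \<Longrightarrow> continuous_on UNIV (w \<alpha>)"
      "\<And>\<alpha>. \<alpha> \<in> {1..N} \<Longrightarrow> continuous_on UNIV (w1 \<alpha>)"
      "\<And>\<alpha>. \<alpha> \<in> {1..N} \<Longrightarrow> continuous_on UNIV (w2 \<alpha>)"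
  obtains Pt Px Qt Qx where "has_partials_on T (total w) Pt Px"
    "has_partials_on T (total (\<lambda>\<alpha> v. fst (vhat (m \<alpha>) v) * w \<alpha> v)) Qt Qx"
    "\<And>z. z \<in> strip T \<Longrightarrow>
       Pt z + Qx z = total (\<lambda>\<alpha> v. fst (force \<alpha> z v) * w1 \<alpha> v + snd (force \<alpha> z v) * w2 \<alpha> v) z"
proof -
  define good where "good \<alpha> Pt Px Qt Qx \<longleftrightarrow> has_partials_on T (moment \<alpha> (w \<alpha>)) Pt Px \<and>
      has_partials_on T (moment \<alpha> (\<lambda>v. fst (vhat (m \<alpha>) v) * w \<alpha> v)) Qt Qx \<and>
      (\<forall>z\<in>strip T. Pt z + Qx z
         = moment \<alpha> (\<lambda>v. fst (force \<alpha> z v) * w1 \<alpha> v + snd (force \<alpha> z v) * w2 \<alpha> v) z)"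
    for \<alpha> Pt Px Qt Qx
  have "\<exists>Pt Px Qt Qx. good \<alpha> Pt Px Qt Qx" if "\<alpha> \<in> {1..N}" for \<alpha>
    unfolding good_def
    by (rule moment_balance[OF that assms(1) w1[OF that] w2[OF that]
          cont(1)[OF that] cont(2)[OF that] cont(3)[OF that]]) blast
  then obtain Pt Px Qt Qx where *: "\<And>\<alpha>. \<alpha> \<in> {1..N} \<Longrightarrow> good \<alpha> (Pt \<alpha>) (Px \<alpha>) (Qt \<alpha>) (Qx \<alpha>)"
    by metis
  show ?thesis
  proof (rule that)
    show "has_partials_on T (total w) (\<lambda>z. \<Sum>\<alpha>=1..N. Pt \<alpha> z) (\<lambda>z. \<Sum>\<alpha>=1..N. Px \<alpha> z)"
      unfolding total_def by (rule has_partials_on_sum) (use * in \<open>simp add: good_def\<close>)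
    show "has_partials_on T (total (\<lambda>\<alpha> v. fst (vhat (m \<alpha>) v) * w \<alpha> v))
        (\<lambda>z. \<Sum>\<alpha>=1..N. Qt \<alpha> z) (\<lambda>z. \<Sum>\<alpha>=1..N. Qx \<alpha> z)"
      unfolding total_def by (rule has_partials_on_sum) (use * in \<open>simp add: good_def\<close>)
    show "(\<Sum>\<alpha>=1..N. Pt \<alpha> z) + (\<Sum>\<alpha>=1..N. Qx \<alpha> z)
        = total (\<lambda>\<alpha> v. fst (force \<alpha> z v) * w1 \<alpha> v + snd (force \<alpha> z v) * w2 \<alpha> v) z"
      if "z \<in> strip T" for z
      unfolding total_def sum.distrib[symmetric]
    proof (rule sum.cong[OF refl])
      fix \<alpha> assume "\<alpha> \<in> {1..N}"
      from *[OF this] that show "Pt \<alpha> z + Qx \<alpha> z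
          = moment \<alpha> (\<lambda>v. fst (force \<alpha> z v) * w1 \<alpha> v + snd (force \<alpha> z v) * w2 \<alpha> v) z"
        unfolding good_def by blast
    qed
  qed
qed

abbreviation charge :: "real \<times> real \<Rightarrow> real" where
  "charge \<equiv> total (\<lambda>\<alpha> v. e \<alpha>)"

abbreviation current1 :: "real \<times> real \<Rightarrow> real" where
  "current1 \<equiv> total (\<lambda>\<alpha> v. fst (vhat (m \<alpha>) v) * e \<alpha>)"

abbreviation current2 :: "real \<times> real \<Rightarrow> real" where
  "current2 \<equiv> total (\<lambda>\<alpha> v. snd (vhat (m \<alpha>) v) * e \<alpha>)"

lemma cont_vhat:
  assumes "\<alpha> \<in> {1..N}"
  shows "continuous_on UNIV (\<lambda>v. fst (vhat (m \<alpha>) v))" "continuous_on UNIV (\<lambda>v. snd (vhat (m \<alpha>) v))"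
  by (intro continuous_on_vhat mass_pos assms continuous_on_id)+

lemma charge_density_eq: "0 \<le> t \<Longrightarrow> charge_density N e f t x = charge (t, x)"
  unfolding charge_density_def by (rule integral_sum_eq_total) auto

lemma snd_current_density_eq:
  assumes "0 \<le> t"
  shows "snd (current_density N e m f t x) = current2 (t, x)"
proof -
  have cont: "continuous_on UNIV (\<lambda>v. fst (vhat (m \<alpha>) v) * e \<alpha>)"
    "continuous_on UNIV (\<lambda>v. snd (vhat (m \<alpha>) v) * e \<alpha>)" if "\<alpha> \<in> {1..N}" for \<alpha>
    by (intro continuous_intros continuous_on_vhat mass_pos that)+
  let ?h = "\<lambda>\<alpha> v. (fst (vhat (m \<alpha>) v) * e \<alpha> * f \<alpha> t x v) *\<^sub>R (1 :: real, 0 :: real)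
      + (snd (vhat (m \<alpha>) v) * e \<alpha> * f \<alpha> t x v) *\<^sub>R (0, 1)"
  have eq: "(e \<alpha> * f \<alpha> t x v) *\<^sub>R vhat (m \<alpha>) v = ?h \<alpha> v" for \<alpha> v
    by (cases "vhat (m \<alpha>) v") (simp add: mult_ac)
  have "integrable lborel (?h \<alpha>)" if "\<alpha> \<in> {1..N}" for \<alpha>
    using integrable_moment[OF that assms cont(1)[OF that]]
      integrable_moment[OF that assms cont(2)[OF that]]
    by (intro Bochner_Integration.integrable_add integrable_scaleR_left) auto
  then have int: "integrable lborel (\<lambda>v. \<Sum>\<alpha>=1..N. ?h \<alpha> v)"
    by (intro Bochner_Integration.integrable_sum) auto
  have "snd (current_density N e m f t x) = (LINT v|lborel. snd (\<Sum>\<alpha>=1..N. ?h \<alpha> v))"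
    unfolding current_density_def eq by (rule integral_bounded_linear[OF bounded_linear_snd int, symmetric])
  also have "\<dots> = (LINT v|lborel. (\<Sum>\<alpha>=1..N. snd (vhat (m \<alpha>) v) * e \<alpha> * f \<alpha> t x v))"
    by (simp add: snd_sum)
  also have "\<dots> = current2 (t, x)"
    by (rule integral_sum_eq_total[OF assms]) (rule cont(2))
  finally show ?thesis .
qed

section \<open>The field equations\<close>

lemma field_partials:
  assumes "C1_on ({0..} \<times> UNIV) (\<lambda>(t, x). g t x)"
  obtains gt gx where "has_partials_on T (\<lambda>z. g (fst z) (snd z)) gt gx"
    "\<And>t x. 0 \<le> t \<Longrightarrow> gt (t, x) = time_deriv (\<lambda>s. g s x) t"
    "\<And>t x. 0 \<le> t \<Longrightarrow> gx (t, x) = deriv (\<lambda>y. g t y) x"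
proof -
  obtain D :: "real \<times> real \<Rightarrow> (real \<times> real) \<Rightarrow>\<^sub>L real" where
    D: "\<And>z. z \<in> {0..} \<times> UNIV \<Longrightarrow>
      ((\<lambda>z. g (fst z) (snd z)) has_derivative blinfun_apply (D z)) (at z within {0..} \<times> UNIV)"
    and cont: "continuous_on ({0..} \<times> UNIV) D"
    using assms unfolding C1_on_def case_prod_beta' by blast
  have lin: "blinfun_apply (D z) h = fst h * blinfun_apply (D z) (1, 0) + snd h * blinfun_apply (D z) (0, 1)"
    for z h
  proof -
    have "h = fst h *\<^sub>R (1, 0) + snd h *\<^sub>R (0, 1)"
      by (cases h) simp
    then show ?thesis
      by (metis blinfun.add_right blinfun.scaleR_right real_scaleR_def)
  qed
  show ?thesis
  proof (rule that)
    have "((\<lambda>z. g (fst z) (snd z)) has_derivative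
        (\<lambda>h. fst h * blinfun_apply (D z) (1, 0) + snd h * blinfun_apply (D z) (0, 1))) (at z within strip T)"
      if "z \<in> strip T" for z
      using that by (intro has_derivative_eq_rhs[OF has_derivative_subset[OF D]]) (auto intro: lin)
    then show "has_partials_on T (\<lambda>z. g (fst z) (snd z))
        (\<lambda>z. blinfun_apply (D z) (1, 0)) (\<lambda>z. blinfun_apply (D z) (0, 1))"
      unfolding has_partials_on_def
      by (auto intro!: continuous_intros continuous_on_subset[OF cont])
  next
    fix t x :: real assume t: "0 \<le> t"
    have "((\<lambda>s. (s, x)) has_vector_derivative (1, 0)) (at t within {0..})"
      by (auto simp: has_vector_derivative_def zero_prod_def intro!: derivative_eq_intros)
    from has_real_derivative_along_curve[where p = "\<lambda>s. (s, x)", OF D this] t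
    show "blinfun_apply (D (t, x)) (1, 0) = time_deriv (\<lambda>s. g s x) t"
      by (intro time_deriv_eq[symmetric]) (auto simp flip: has_real_derivative_iff_has_vector_derivative)
    have "((\<lambda>y. (t, y)) has_vector_derivative (0, 1)) (at x)"
      by (auto simp: has_vector_derivative_def zero_prod_def intro!: derivative_eq_intros)
    from has_real_derivative_along_curve[where p = "\<lambda>y. (t, y)", OF D this] t
    show "blinfun_apply (D (t, x)) (0, 1) = deriv (\<lambda>y. g t y) x"
      by (intro DERIV_imp_deriv[symmetric]) auto
  qed
qed

lemma maxwell_partials:
  obtains E2t E2x Bt Bx where
    "has_partials_on T (\<lambda>z. E2 (fst z) (snd z)) E2t E2x" "has_partials_on T (\<lambda>z. B (fst z) (snd z)) Bt Bx"
    "\<And>z. z \<in> strip T \<Longrightarrow> E2t z + Bx z = - current2 z" "\<And>z. z \<in> strip T \<Longrightarrow> Bt z + E2x z = 0"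
proof -
  have C1: "C1_on ({0..} \<times> UNIV) (\<lambda>(t, x). E2 t x)" "C1_on ({0..} \<times> UNIV) (\<lambda>(t, x). B t x)"
    using solution unfolding global_C1_solution_def by blast+
  obtain E2t E2x where E2: "has_partials_on T (\<lambda>z. E2 (fst z) (snd z)) E2t E2x"
    "\<And>t x. 0 \<le> t \<Longrightarrow> E2t (t, x) = time_deriv (\<lambda>s. E2 s x) t"
    "\<And>t x. 0 \<le> t \<Longrightarrow> E2x (t, x) = deriv (\<lambda>y. E2 t y) x"
    by (rule field_partials[where T = T, OF C1(1)]) (rule that)
  obtain Bt Bx where B: "has_partials_on T (\<lambda>z. B (fst z) (snd z)) Bt Bx"
    "\<And>t x. 0 \<le> t \<Longrightarrow> Bt (t, x) = time_deriv (\<lambda>s. B s x) t"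
    "\<And>t x. 0 \<le> t \<Longrightarrow> Bx (t, x) = deriv (\<lambda>y. B t y) x"
    by (rule field_partials[where T = T, OF C1(2)]) (rule that)
  have "time_deriv (\<lambda>s. E2 s x) t + deriv (\<lambda>y. B t y) x = - snd (current_density N e m f t x)"
    "time_deriv (\<lambda>s. B s x) t + deriv (\<lambda>y. E2 t y) x = 0" if "0 \<le> t" for t x
    using solution that unfolding global_C1_solution_def by blast+
  then show ?thesis
    by (intro that[OF E2(1) B(1)]) (auto simp: E2(2,3) B(2,3) snd_current_density_eq)
qed

lemma E1_formula:
  assumes "0 \<le> t"
  shows "E1 t x = 1/2 * (LBINT y:{..x}. charge (t, y)) - 1/2 * (LBINT y:{x..}. charge (t, y))"
proof -
  have "E1 t x = 1/2 * (LBINT y:{..x}. charge_density N e f t y)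
                 - 1/2 * (LBINT y:{x..}. charge_density N e f t y)"
    using solution assms unfolding global_C1_solution_def by blast
  then show ?thesis by (simp only: charge_density_eq[OF assms])
qed

text \<open>
Charge conservation yields a potential \<open>\<Psi>\<close> of the pair (charge, current). Outside the light cone of the
data the current and the charge vanish, so \<open>\<Psi>\<close> is constant on each of the two outer regions, and the
integral formula shows that \<open>E1\<close> differs from \<open>\<Psi>\<close> by the mean of the two constants. This gives
Gauss' law and Ampere's law for \<open>E1\<close> together.
\<close>
lemma gauss_ampere_partials:
  assumes "0 \<le> T"
  shows "has_partials_on T (\<lambda>z. E1 (fst z) (snd z)) (\<lambda>z. - current1 z) charge"
proof -
  obtain Pt Px Qt Qx where P: "has_partials_on T charge Pt Px" and Q: "has_partials_on T current1 Qt Qx"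
    and "\<And>z. z \<in> strip T \<Longrightarrow>
       Pt z + Qx z = total (\<lambda>\<alpha> v. fst (force \<alpha> z v) * 0 + snd (force \<alpha> z v) * 0) z"
    by (rule total_balance[OF assms, where w = "\<lambda>\<alpha> v. e \<alpha>" and ?w1.0 = "\<lambda>\<alpha> v. 0" and ?w2.0 = "\<lambda>\<alpha> v. 0"]) auto
  then have law: "Pt z + Qx z = 0" if "z \<in> strip T" for z
    using that by (simp add: total_def moment_def)
  obtain \<Psi> where \<Psi>: "has_partials_on T \<Psi> (\<lambda>z. - current1 z) charge"
    using conservation_law_potential[OF P Q law assms] by blast
  have "\<Psi> z - (\<Psi> (0, C0) + \<Psi> (0, - C0)) / 2 = E1 (fst z) (snd z)" if z: "z \<in> strip T" for z
  proof -
    obtain t x where zeq: "z = (t, x)" and t: "t \<in> {0..T}"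
      using z by auto
    \<comment> \<open>far enough out that \<open>\<plusminus>L\<close> is outside the light cone up to time \<open>T\<close> and beyond \<open>x\<close>\<close>
    define L where "L = C0 + T + \<bar>x\<bar>"
    have L: "C0 + s \<le> \<bar>L\<bar>" "C0 + s \<le> \<bar>- L\<bar>" if "s \<le> T" for s
      using that assms C0_pos by (auto simp: L_def)
    have \<Psi>_time: "\<Psi> (t, y) = \<Psi> (0, y)" if "\<bar>y\<bar> = L" for y
    proof -
      have "((\<lambda>s. - current1 (s, y)) has_integral \<Psi> (t, y) - \<Psi> (0, y)) {0..t}"
        using has_integral_along_line[OF \<Psi> t, of y 0] by simp
      moreover have "- current1 (s, y) = 0" if "s \<in> {0..t}" for s
        using that t \<open>\<bar>y\<bar> = L\<close> L[of s] by (simp add: total_eq_0_outside_light_cone)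
      ultimately have "((\<lambda>s. 0) has_integral \<Psi> (t, y) - \<Psi> (0, y)) {0..t}"
        by (rule has_integral_eq[rotated])
      then show ?thesis by (simp add: has_integral_0_eq)
    qed
    have zero: "charge (0, y) = 0" if "C0 \<le> \<bar>y\<bar>" for y
      using that by (simp add: total_eq_0_outside_light_cone)
    have flat: "((\<lambda>y. \<Psi> (0, y)) has_real_derivative 0) (at y)" if "C0 \<le> \<bar>y\<bar>" for y
      using has_partials_on_snd[OF \<Psi>, of 0 y] zero[OF that] assms by simp
    have right: "\<Psi> (0, L) = \<Psi> (0, C0)"
      by (rule deriv_zero_imp_eq[where g = "\<lambda>y. \<Psi> (0, y)", symmetric])
        (use assms in \<open>auto simp: L_def intro: flat\<close>)
    have left: "\<Psi> (0, - L) = \<Psi> (0, - C0)"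
      by (rule deriv_zero_imp_eq[where g = "\<lambda>y. \<Psi> (0, y)"])
        (use assms in \<open>auto simp: L_def intro: flat\<close>)
    have "(LBINT y:{..x}. charge (t, y)) = (LBINT y:{-L..x}. charge (t, y))"
      unfolding set_lebesgue_integral_def using t
      by (intro Bochner_Integration.integral_cong refl)
        (auto simp: indicator_def total_eq_0_outside_light_cone L_def)
    also have "\<dots> = \<Psi> (t, x) - \<Psi> (t, - L)"
      using assms C0_pos by (intro has_partials_on_snd_integral[OF \<Psi> t]) (auto simp: L_def)
    finally have 1: "(LBINT y:{..x}. charge (t, y)) = \<Psi> (t, x) - \<Psi> (t, - L)" .
    have "(LBINT y:{x..}. charge (t, y)) = (LBINT y:{x..L}. charge (t, y))"
      unfolding set_lebesgue_integral_def using t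
      by (intro Bochner_Integration.integral_cong refl)
        (auto simp: indicator_def total_eq_0_outside_light_cone L_def)
    also have "\<dots> = \<Psi> (t, L) - \<Psi> (t, x)"
      using assms C0_pos by (intro has_partials_on_snd_integral[OF \<Psi> t]) (auto simp: L_def)
    finally have 2: "(LBINT y:{x..}. charge (t, y)) = \<Psi> (t, L) - \<Psi> (t, x)" .
    have "0 \<le> L" using assms C0_pos by (simp add: L_def)
    then show ?thesis
      using t \<Psi>_time[of L] \<Psi>_time[of "- L"] by (simp add: zeq E1_formula 1 2 left right diff_divide_distrib add_divide_distrib)
  qed
  then show ?thesis
    by (intro has_partials_on_cong[OF has_partials_on_minus[OF \<Psi> has_partials_on_const]]) auto
qed

section \<open>Conservation of energy and momentum\<close>

definition energy :: "real \<times> real \<Rightarrow> real" where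
  "energy z = total (\<lambda>\<alpha>. rel_energy (m \<alpha>)) z
     + ((E1 (fst z) (snd z))\<^sup>2 + (E2 (fst z) (snd z))\<^sup>2 + (B (fst z) (snd z))\<^sup>2) / 2"

definition momentum :: "real \<times> real \<Rightarrow> real" where
  "momentum z = total (\<lambda>\<alpha> v. fst v) z + E2 (fst z) (snd z) * B (fst z) (snd z)"

definition pressure :: "real \<times> real \<Rightarrow> real" where
  "pressure z = total (\<lambda>\<alpha> v. fst (vhat (m \<alpha>) v) * fst v) z
     + ((E2 (fst z) (snd z))\<^sup>2 + (B (fst z) (snd z))\<^sup>2 - (E1 (fst z) (snd z))\<^sup>2) / 2"

text \<open>
The weight \<open>sqrt (m\<^sup>2 + |v|\<^sup>2)\<close> has gradient \<open>vhat\<close>, so that its moments change by the work of the electric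
field; the magnetic field does no work.
\<close>
lemma energy_balance:
  assumes "0 \<le> T"
  obtains Pt Px Qt Qx where "has_partials_on T (total (\<lambda>\<alpha>. rel_energy (m \<alpha>))) Pt Px"
    "has_partials_on T (total (\<lambda>\<alpha> v. fst v)) Qt Qx"
    "\<And>z. z \<in> strip T \<Longrightarrow> Pt z + Qx z = E1 (fst z) (snd z) * current1 z + E2 (fst z) (snd z) * current2 z"
proof -
  obtain Pt Px Qt Qx where P: "has_partials_on T (total (\<lambda>\<alpha>. rel_energy (m \<alpha>))) Pt Px"
    and Q: "has_partials_on T (total (\<lambda>\<alpha> v. fst (vhat (m \<alpha>) v) * rel_energy (m \<alpha>) v)) Qt Qx"
    and PQ: "\<And>z. z \<in> strip T \<Longrightarrow> Pt z + Qx z = total (\<lambda>\<alpha> v. fst (force \<alpha> z v) * fst (vhat (m \<alpha>) v)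
        + snd (force \<alpha> z v) * snd (vhat (m \<alpha>) v)) z"
    by (rule total_balance[OF assms, where w = "\<lambda>\<alpha>. rel_energy (m \<alpha>)"
          and ?w1.0 = "\<lambda>\<alpha> v. fst (vhat (m \<alpha>) v)" and ?w2.0 = "\<lambda>\<alpha> v. snd (vhat (m \<alpha>) v)",
          OF rel_energy_has_derivative(1)[OF mass_pos] rel_energy_has_derivative(2)[OF mass_pos]
          continuous_on_rel_energy[OF continuous_on_id] cont_vhat]) (assumption | rule that)+
  have total_eq: "total (\<lambda>\<alpha> v. fst (vhat (m \<alpha>) v) * rel_energy (m \<alpha>) v) = total (\<lambda>\<alpha> v. fst v)"
  proof (rule ext, rule total_cong)
    show "fst (vhat (m \<alpha>) v) * rel_energy (m \<alpha>) v = fst v" if "\<alpha> \<in> {1..N}" for \<alpha> v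
      using rel_energy_pos[OF mass_pos[OF that], of v] by (simp add: fst_vhat)
  qed
  have "Pt z + Qx z = E1 (fst z) (snd z) * current1 z + E2 (fst z) (snd z) * current2 z"
    if "z \<in> strip T" for z
  proof -
    have "total (\<lambda>\<alpha> v. fst (force \<alpha> z v) * fst (vhat (m \<alpha>) v) + snd (force \<alpha> z v) * snd (vhat (m \<alpha>) v)) z
        = total (\<lambda>\<alpha> v. E1 (fst z) (snd z) * (fst (vhat (m \<alpha>) v) * e \<alpha>)
            + E2 (fst z) (snd z) * (snd (vhat (m \<alpha>) v) * e \<alpha>)) (fst z, snd z)"
      by (simp add: force_def algebra_simps)
    also have "\<dots> = E1 (fst z) (snd z) * current1 z + E2 (fst z) (snd z) * current2 z"
      using that by (subst total_linear) (auto intro!: continuous_intros cont_vhat)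
    finally show ?thesis using PQ[OF that] by simp
  qed
  with P Q[unfolded total_eq] show ?thesis by (rule that)
qed

lemma momentum_balance:
  assumes "0 \<le> T"
  obtains Pt Px Qt Qx where "has_partials_on T (total (\<lambda>\<alpha> v. fst v)) Pt Px"
    "has_partials_on T (total (\<lambda>\<alpha> v. fst (vhat (m \<alpha>) v) * fst v)) Qt Qx"
    "\<And>z. z \<in> strip T \<Longrightarrow> Pt z + Qx z = E1 (fst z) (snd z) * charge z + B (fst z) (snd z) * current2 z"
proof -
  obtain Pt Px Qt Qx where P: "has_partials_on T (total (\<lambda>\<alpha> v. fst v)) Pt Px"
    and Q: "has_partials_on T (total (\<lambda>\<alpha> v. fst (vhat (m \<alpha>) v) * fst v)) Qt Qx"
    and PQ: "\<And>z. z \<in> strip T \<Longrightarrow>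
        Pt z + Qx z = total (\<lambda>\<alpha> v. fst (force \<alpha> z v) * 1 + snd (force \<alpha> z v) * 0) z"
    by (rule total_balance[OF assms, where w = "\<lambda>\<alpha> v. fst v"
          and ?w1.0 = "\<lambda>\<alpha> v. 1" and ?w2.0 = "\<lambda>\<alpha> v. 0"])
      (auto intro: continuous_intros)
  have "Pt z + Qx z = E1 (fst z) (snd z) * charge z + B (fst z) (snd z) * current2 z"
    if "z \<in> strip T" for z
  proof -
    have "total (\<lambda>\<alpha> v. fst (force \<alpha> z v) * 1 + snd (force \<alpha> z v) * 0) z
        = total (\<lambda>\<alpha> v. E1 (fst z) (snd z) * e \<alpha>
            + B (fst z) (snd z) * (snd (vhat (m \<alpha>) v) * e \<alpha>)) (fst z, snd z)"
      by (simp add: force_def algebra_simps)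
    also have "\<dots> = E1 (fst z) (snd z) * charge z + B (fst z) (snd z) * current2 z"
      using that by (subst total_linear) (auto intro!: continuous_intros cont_vhat)
    finally show ?thesis using PQ[OF that] by simp
  qed
  with P Q show ?thesis by (rule that)
qed

text \<open>
The source terms of the particle balances are cancelled by those of Maxwell's equations; for
the momentum this uses both Gauss' law, in \<open>E1\<^sup>2 / 2\<close>, and the two evolution equations, in \<open>E2 B\<close>.
\<close>
lemma energy_momentum_potentials:
  assumes "0 \<le> T"
  obtains \<Psi> \<Phi> where "has_partials_on T \<Psi> (\<lambda>z. - momentum z) energy"
    "has_partials_on T \<Phi> (\<lambda>z. - pressure z) momentum"
proof -
  note E1 = gauss_ampere_partials[OF assms]
  obtain E2t E2x Bt Bx where
    E2: "has_partials_on T (\<lambda>z. E2 (fst z) (snd z)) E2t E2x" and B: "has_partials_on T (\<lambda>z. B (fst z) (snd z)) Bt Bx"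
    and maxwell: "\<And>z. z \<in> strip T \<Longrightarrow> E2t z + Bx z = - current2 z" "\<And>z. z \<in> strip T \<Longrightarrow> Bt z + E2x z = 0"
    by (rule maxwell_partials[where T = T]) (rule that)
  have E2B: "has_partials_on T (\<lambda>z. E2 (fst z) (snd z) * B (fst z) (snd z))
      (\<lambda>z. E2t z * B (fst z) (snd z) + E2 (fst z) (snd z) * Bt z)
      (\<lambda>z. E2x z * B (fst z) (snd z) + E2 (fst z) (snd z) * Bx z)"
    by (rule has_partials_on_mult[OF E2 B])
  note sq = has_partials_on_mult[OF E1 E1] has_partials_on_mult[OF E2 E2] has_partials_on_mult[OF B B]
  obtain Pt Px Qt Qx where P: "has_partials_on T (total (\<lambda>\<alpha>. rel_energy (m \<alpha>))) Pt Px"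
    and Q: "has_partials_on T (total (\<lambda>\<alpha> v. fst v)) Qt Qx"
    and work: "\<And>z. z \<in> strip T \<Longrightarrow>
        Pt z + Qx z = E1 (fst z) (snd z) * current1 z + E2 (fst z) (snd z) * current2 z"
    by (rule energy_balance[OF assms]) (rule that)
  obtain Mt Mx St Sx where M: "has_partials_on T (total (\<lambda>\<alpha> v. fst v)) Mt Mx"
    and S: "has_partials_on T (total (\<lambda>\<alpha> v. fst (vhat (m \<alpha>) v) * fst v)) St Sx"
    and thrust: "\<And>z. z \<in> strip T \<Longrightarrow>
        Mt z + Sx z = E1 (fst z) (snd z) * charge z + B (fst z) (snd z) * current2 z"
    by (rule momentum_balance[OF assms]) (rule that)
  have energy_eq: "energy = (\<lambda>z. total (\<lambda>\<alpha>. rel_energy (m \<alpha>)) z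
     + 1/2 * (E1 (fst z) (snd z) * E1 (fst z) (snd z) + E2 (fst z) (snd z) * E2 (fst z) (snd z)
        + B (fst z) (snd z) * B (fst z) (snd z)))"
    and momentum_eq: "momentum = (\<lambda>z. total (\<lambda>\<alpha> v. fst v) z + E2 (fst z) (snd z) * B (fst z) (snd z))"
    and pressure_eq: "pressure = (\<lambda>z. total (\<lambda>\<alpha> v. fst (vhat (m \<alpha>) v) * fst v) z
     + 1/2 * (E2 (fst z) (snd z) * E2 (fst z) (snd z) + B (fst z) (snd z) * B (fst z) (snd z)
        - E1 (fst z) (snd z) * E1 (fst z) (snd z)))"
    by (auto simp: energy_def momentum_def pressure_def power2_eq_square)
  note energy_partials = has_partials_on_add[OF P has_partials_on_cmult[where c = "1/2", OF
      has_partials_on_add[OF has_partials_on_add[OF sq(1,2)] sq(3)]], folded energy_eq]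
  note momentum_partials = has_partials_on_add[OF Q E2B, folded momentum_eq]
  note momentum_partials' = has_partials_on_add[OF M E2B, folded momentum_eq]
  note pressure_partials = has_partials_on_add[OF S has_partials_on_cmult[where c = "1/2", OF
      has_partials_on_minus[OF has_partials_on_add[OF sq(2,3)] sq(1)]], folded pressure_eq]
  show ?thesis
  proof (rule conservation_law_potential[OF energy_partials momentum_partials _ assms],
      goal_cases)
    case (1 z)
    then show ?case
      using work[OF 1] maxwell[OF 1] by algebra
  next
    case (2 \<Psi>)
    show ?thesis
    proof (rule conservation_law_potential[OF momentum_partials' pressure_partials _ assms],
        goal_cases)
      case (1 z)
      then show ?case
        using thrust[OF 1] maxwell[OF 1] by algebra
    next
      case (2 \<Phi>)
      with \<open>has_partials_on T \<Psi> _ _\<close> show ?thesis by (rule that)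
    qed
  qed
qed

section \<open>Fluxes through the lines of slope 1 and -1\<close>

lemma continuous_on_total:
  assumes "0 \<le> T"
  shows "continuous_on (strip T) (total (\<lambda>\<alpha>. rel_energy (m \<alpha>)))"
    and "continuous_on (strip T) (total (\<lambda>\<alpha> v. fst v))"
    and "continuous_on (strip T) (total (\<lambda>\<alpha> v. fst (vhat (m \<alpha>) v) * fst v))"
proof -
  show "continuous_on (strip T) (total (\<lambda>\<alpha>. rel_energy (m \<alpha>)))"
    by (rule energy_balance[OF assms]) (erule has_partials_on_continuous)
  show "continuous_on (strip T) (total (\<lambda>\<alpha> v. fst v))"
    by (rule momentum_balance[OF assms]) (erule has_partials_on_continuous)
  show "continuous_on (strip T) (total (\<lambda>\<alpha> v. fst (vhat (m \<alpha>) v) * fst v))"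
    by (rule momentum_balance[OF assms]) (rule has_partials_on_continuous)
qed

lemma continuous_on_fields_strip:
  "continuous_on (strip T) (\<lambda>z. E1 (fst z) (snd z))"
  "continuous_on (strip T) (\<lambda>z. E2 (fst z) (snd z))"
  "continuous_on (strip T) (\<lambda>z. B (fst z) (snd z))"
  by (rule continuous_on_subset, rule continuous_on_fields, force)+

lemma total_rel_energy_minus_fst:
  assumes "0 \<le> t"
  shows "total (\<lambda>\<alpha> v. rel_energy (m \<alpha>) v - \<sigma> * fst v) (t, x)
       = total (\<lambda>\<alpha>. rel_energy (m \<alpha>)) (t, x) - \<sigma> * total (\<lambda>\<alpha> v. fst v) (t, x)"
  using total_linear[OF assms, of "\<lambda>\<alpha>. rel_energy (m \<alpha>)" "\<lambda>\<alpha> v. fst v" 1 "- \<sigma>" x]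
  by (simp add: continuous_intros)

text \<open>
Here and below \<open>\<sigma>\<close> is 1 or -1, the slope of the line through which fluxes are taken; the reflection
\<open>x \<mapsto> -x\<close> exchanges the two cases.
\<close>
lemma energy_minus_momentum:
  assumes "0 \<le> t" and \<sigma>: "\<sigma>\<^sup>2 = 1"
  shows "2 * (energy (t, x) - \<sigma> * momentum (t, x))
       = (E1 t x)\<^sup>2 + (E2 t x - \<sigma> * B t x)\<^sup>2 + 2 * total (\<lambda>\<alpha> v. rel_energy (m \<alpha>) v - \<sigma> * fst v) (t, x)"
  unfolding energy_def momentum_def total_rel_energy_minus_fst[OF assms(1)]
  using \<sigma> by (simp add: power2_diff power_mult_distrib algebra_simps)

lemma total_rel_energy_minus_fst_nonneg:
  assumes "0 \<le> t" and \<sigma>: "\<sigma>\<^sup>2 = 1"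
  shows "0 \<le> total (\<lambda>\<alpha> v. rel_energy (m \<alpha>) v - \<sigma> * fst v) (t, x)"
proof (rule total_nonneg[OF assms(1)])
  show "0 \<le> rel_energy (m \<alpha>) v - \<sigma> * fst v" for \<alpha> v
    using \<sigma> abs_fst_le_rel_energy[of v "m \<alpha>"] by (auto simp: power2_eq_1_iff)
qed

lemma energy_minus_momentum_nonneg:
  assumes "0 \<le> t" and \<sigma>: "\<sigma>\<^sup>2 = 1"
  shows "0 \<le> energy (t, x) - \<sigma> * momentum (t, x)"
proof -
  have "0 \<le> 2 * (energy (t, x) - \<sigma> * momentum (t, x))"
    unfolding energy_minus_momentum[OF assms]
    using total_rel_energy_minus_fst_nonneg[OF assms, of x] by simp
  then show ?thesis by simp
qed

lemma energy_flux_through_characteristic: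
  assumes \<Psi>: "has_partials_on T \<Psi> (\<lambda>z. - momentum z) energy" and t: "t \<in> {0..T}"
    and \<sigma>: "\<sigma>\<^sup>2 = 1" and y: "\<And>\<tau>. y \<tau> = x + \<sigma> * (\<tau> - t)"
  shows "(LBINT \<tau>:{0..t}. (E1 \<tau> (y \<tau>))\<^sup>2 + (E2 \<tau> (y \<tau>) - \<sigma> * B \<tau> (y \<tau>))\<^sup>2
           + (LINT v|lborel. (\<Sum>\<alpha>=1..N. f \<alpha> \<tau> (y \<tau>) v * (rel_energy (m \<alpha>) v - \<sigma> * fst v))))
         \<le> 2 * \<sigma> * (\<Psi> (t, x) - \<Psi> (0, x - \<sigma> * t))"
proof -
  have T: "0 \<le> T" using t by simp
  define G where "G z = (E1 (fst z) (snd z))\<^sup>2 + (E2 (fst z) (snd z) - \<sigma> * B (fst z) (snd z))\<^sup>2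
      + (total (\<lambda>\<alpha>. rel_energy (m \<alpha>)) z - \<sigma> * total (\<lambda>\<alpha> v. fst v) z)" for z
  have "continuous_on (strip T) G"
    unfolding G_def
    by (intro continuous_intros continuous_on_total[OF T] continuous_on_fields_strip)
  then have cont: "continuous_on {0..t} (\<lambda>\<tau>. G (\<tau>, y \<tau>))"
    unfolding y by (rule continuous_on_compose2) (use t in \<open>auto intro!: continuous_intros\<close>)
  have G_eq: "(LINT v|lborel. (\<Sum>\<alpha>=1..N. f \<alpha> \<tau> (y \<tau>) v * (rel_energy (m \<alpha>) v - \<sigma> * fst v)))
      = total (\<lambda>\<alpha> v. rel_energy (m \<alpha>) v - \<sigma> * fst v) (\<tau>, y \<tau>)" if "0 \<le> \<tau>" for \<tau>
    using integral_sum_eq_total[OF that, of "\<lambda>\<alpha> v. rel_energy (m \<alpha>) v - \<sigma> * fst v" "y \<tau>"]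
    by (simp add: mult.commute continuous_intros)
  have "(LBINT \<tau>:{0..t}. (E1 \<tau> (y \<tau>))\<^sup>2 + (E2 \<tau> (y \<tau>) - \<sigma> * B \<tau> (y \<tau>))\<^sup>2
           + (LINT v|lborel. (\<Sum>\<alpha>=1..N. f \<alpha> \<tau> (y \<tau>) v * (rel_energy (m \<alpha>) v - \<sigma> * fst v))))
      = (LBINT \<tau>:{0..t}. G (\<tau>, y \<tau>))"
    by (intro set_lebesgue_integral_cong) (auto simp: G_def G_eq total_rel_energy_minus_fst simp del: One_nat_def)
  also have "\<dots> = integral {0..t} (\<lambda>\<tau>. G (\<tau>, y \<tau>))"
    by (rule set_lebesgue_integral_eq_integral_Icc[OF cont])
  also have "\<dots> \<le> 2 * \<sigma> * (\<Psi> (t, x) - \<Psi> (0, x - \<sigma> * t))"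
  proof (rule has_integral_le[OF integrable_integral[OF integrable_continuous_real[OF cont]]])
    have "((\<lambda>\<tau>. - momentum (\<tau>, y \<tau>) + \<sigma> * energy (\<tau>, y \<tau>)) has_integral
        \<Psi> (t, x) - \<Psi> (0, x - \<sigma> * t)) {0..t}"
      using has_integral_along_line[OF \<Psi> t, of x \<sigma>] by (simp add: y)
    then show "((\<lambda>\<tau>. 2 * \<sigma> * (- momentum (\<tau>, y \<tau>) + \<sigma> * energy (\<tau>, y \<tau>))) has_integral
        2 * \<sigma> * (\<Psi> (t, x) - \<Psi> (0, x - \<sigma> * t))) {0..t}"
      by (rule has_integral_mult_right)
    fix \<tau> assume "\<tau> \<in> {0..t}"
    then have \<tau>: "0 \<le> \<tau>" by simp
    have "2 * \<sigma> * (- momentum (\<tau>, y \<tau>) + \<sigma> * energy (\<tau>, y \<tau>))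
        = 2 * (energy (\<tau>, y \<tau>) - \<sigma> * momentum (\<tau>, y \<tau>))"
      using \<sigma> by algebra
    then show "G (\<tau>, y \<tau>) \<le> 2 * \<sigma> * (- momentum (\<tau>, y \<tau>) + \<sigma> * energy (\<tau>, y \<tau>))"
      using energy_minus_momentum[OF \<tau> \<sigma>, of "y \<tau>"] total_rel_energy_minus_fst_nonneg[OF \<tau> \<sigma>, of "y \<tau>"]
      by (simp add: G_def total_rel_energy_minus_fst \<tau>)
  qed
  finally show ?thesis .
qed

text \<open>
The squares of \<open>E1\<close> in the energy and in the pressure cancel, so this combination is controlled even
when \<open>E1\<close> does not decay in space.
\<close>
lemma energy_momentum_pressure:
  assumes "0 \<le> t" and \<sigma>: "\<sigma>\<^sup>2 = 1"
  shows "energy (t, x) - 2 * \<sigma> * momentum (t, x) + pressure (t, x)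
       = (E2 t x - \<sigma> * B t x)\<^sup>2 + total (\<lambda>\<alpha> v. (rel_energy (m \<alpha>) v - \<sigma> * fst v)\<^sup>2 / rel_energy (m \<alpha>) v) (t, x)"
proof -
  have cont: "continuous_on UNIV (\<lambda>v. fst (vhat (m \<alpha>) v) * fst v)" if "\<alpha> \<in> {1..N}" for \<alpha>
    by (intro continuous_on_mult cont_vhat that continuous_on_fst continuous_on_id)
  have cont_diff: "continuous_on UNIV (\<lambda>v. rel_energy (m \<alpha>) v - 2 * \<sigma> * fst v)" for \<alpha>
    by (intro continuous_intros)
  have "total (\<lambda>\<alpha> v. (rel_energy (m \<alpha>) v - \<sigma> * fst v)\<^sup>2 / rel_energy (m \<alpha>) v) (t, x)
      = total (\<lambda>\<alpha> v. 1 * (rel_energy (m \<alpha>) v - 2 * \<sigma> * fst v) + 1 * (fst (vhat (m \<alpha>) v) * fst v)) (t, x)"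
  proof (rule total_cong)
    fix \<alpha> v assume "\<alpha> \<in> {1..N}"
    then have "0 < rel_energy (m \<alpha>) v" by (intro rel_energy_pos mass_pos)
    then show "(rel_energy (m \<alpha>) v - \<sigma> * fst v)\<^sup>2 / rel_energy (m \<alpha>) v
        = 1 * (rel_energy (m \<alpha>) v - 2 * \<sigma> * fst v) + 1 * (fst (vhat (m \<alpha>) v) * fst v)"
      using \<sigma> by (simp add: fst_vhat field_simps power2_diff power_mult_distrib) (simp add: power2_eq_square)
  qed
  also have "\<dots> = total (\<lambda>\<alpha>. rel_energy (m \<alpha>)) (t, x) - 2 * \<sigma> * total (\<lambda>\<alpha> v. fst v) (t, x)
      + total (\<lambda>\<alpha> v. fst (vhat (m \<alpha>) v) * fst v) (t, x)"
    using cont_diff cont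
    by (subst total_linear[OF assms(1)]) (auto simp: total_rel_energy_minus_fst[OF assms(1)])
  finally show ?thesis
    using \<sigma> by (simp add: energy_def momentum_def pressure_def power2_diff power_mult_distrib field_simps)
qed

text \<open>
\<open>E2 - \<sigma> B\<close> is transported along lines of slope \<open>- \<sigma>\<close> with source \<open>- current2\<close>. The line that ends on
the extreme ray \<open>x = \<sigma> (C0 + t)\<close> runs outside the light cone of the data, where there is no current, and
starts where the fields vanish.
\<close>
lemma characteristic_field_vanishes:
  assumes "0 \<le> t" and \<sigma>: "\<sigma>\<^sup>2 = 1"
  shows "E2 t (\<sigma> * (C0 + t)) - \<sigma> * B t (\<sigma> * (C0 + t)) = 0"
proof -
  obtain E2t E2x Bt Bx where
    E2: "has_partials_on t (\<lambda>z. E2 (fst z) (snd z)) E2t E2x" and B: "has_partials_on t (\<lambda>z. B (fst z) (snd z)) Bt Bx"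
    and maxwell: "\<And>z. z \<in> strip t \<Longrightarrow> E2t z + Bx z = - current2 z" "\<And>z. z \<in> strip t \<Longrightarrow> Bt z + E2x z = 0"
    by (rule maxwell_partials[where T = t]) (rule that)
  define y where "y s = \<sigma> * (C0 + t) + (- \<sigma>) * (s - t)" for s
  have y_eq: "y s = \<sigma> * (C0 + 2 * t - s)" for s
    by (simp add: y_def algebra_simps)
  have abs_\<sigma>: "\<bar>\<sigma>\<bar> = 1"
    using \<sigma> by (auto simp: power2_eq_1_iff)
  have abs_y: "C0 + s \<le> \<bar>y s\<bar>" if "s \<le> t" for s
    using that assms(1) C0_pos by (simp add: y_eq abs_mult abs_\<sigma>)
  have "((\<lambda>s. (E2t (s, y s) - \<sigma> * Bt (s, y s)) + (- \<sigma>) * (E2x (s, y s) - \<sigma> * Bx (s, y s))) has_integral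
      (E2 t (\<sigma> * (C0 + t)) - \<sigma> * B t (\<sigma> * (C0 + t))) - (E2 0 (y 0) - \<sigma> * B 0 (y 0))) {0..t}"
    using has_integral_along_line[OF has_partials_on_minus[OF E2 has_partials_on_cmult[OF B, of \<sigma>]],
        of t "\<sigma> * (C0 + t)" "- \<sigma>"] assms(1)
    by (simp add: y_def algebra_simps)
  moreover have "(E2t (s, y s) - \<sigma> * Bt (s, y s)) + (- \<sigma>) * (E2x (s, y s) - \<sigma> * Bx (s, y s)) = 0"
    if "s \<in> {0..t}" for s
  proof -
    have "current2 (s, y s) = 0"
      using that by (intro total_eq_0_outside_light_cone abs_y) auto
    then show ?thesis
      using maxwell[of "(s, y s)"] that \<sigma> by simp algebra
  qed
  ultimately have "((\<lambda>s. 0) has_integral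
      (E2 t (\<sigma> * (C0 + t)) - \<sigma> * B t (\<sigma> * (C0 + t))) - (E2 0 (y 0) - \<sigma> * B 0 (y 0))) {0..t}"
    by (rule has_integral_eq[rotated])
  moreover have "E2 0 (y 0) = 0" "B 0 (y 0) = 0"
    using vanish abs_y[OF assms(1)] assms(1) initial_values abs_y[of 0]
    unfolding data_vanish_outside_def by auto
  ultimately show ?thesis
    by (simp add: has_integral_0_eq)
qed

text \<open>
\<open>\<Theta> = \<Psi> - \<sigma> \<Phi>\<close> is a potential of the conserved density energy \<open>- \<sigma>\<close> momentum \<open>\<ge> 0\<close>, and \<open>\<sigma> \<Theta>\<close> has derivative
\<open>K\<close>, the integrand, along lines of slope \<open>\<sigma>\<close>. The reflected function \<open>h s r = \<sigma> \<Theta> (s, \<sigma> r)\<close> is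
nondecreasing in \<open>r\<close>, and \<open>h t (C0 + t) = h 0 C0\<close>, since \<open>K = 0\<close> on the extreme ray. So the flux
\<open>h t (\<sigma> x) - h 0 (\<sigma> x - t)\<close> is at most \<open>h 0 C0 - h 0 (\<sigma> x - t)\<close>, which depends on the data only.
\<close>
lemma momentum_flux_through_characteristic:
  assumes "0 \<le> t" and \<sigma>: "\<sigma>\<^sup>2 = 1" and y: "\<And>\<tau>. y \<tau> = x + \<sigma> * (\<tau> - t)" and x: "\<sigma> * x \<le> C0 + t"
    and S: "\<And>r. energy (0, r) \<le> S"
  shows "(LBINT \<tau>:{0..t}. (E2 \<tau> (y \<tau>) - \<sigma> * B \<tau> (y \<tau>))\<^sup>2
           + (LINT v|lborel. (\<Sum>\<alpha>=1..N. f \<alpha> \<tau> (y \<tau>) v * ((rel_energy (m \<alpha>) v - \<sigma> * fst v)\<^sup>2 / rel_energy (m \<alpha>) v))))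
         \<le> 2 * S * (C0 + t - \<sigma> * x)"
proof -
  obtain \<Psi> \<Phi> where \<Psi>: "has_partials_on t \<Psi> (\<lambda>z. - momentum z) energy"
    and \<Phi>: "has_partials_on t \<Phi> (\<lambda>z. - pressure z) momentum"
    by (rule energy_momentum_potentials[OF assms(1)])
  define \<Theta> where "\<Theta> z = \<Psi> z - \<sigma> * \<Phi> z" for z
  have \<Theta>: "has_partials_on t \<Theta> (\<lambda>z. - momentum z - \<sigma> * (- pressure z)) (\<lambda>z. energy z - \<sigma> * momentum z)"
    unfolding \<Theta>_def by (rule has_partials_on_minus[OF \<Psi> has_partials_on_cmult[OF \<Phi>]])
  define K where "K z = energy z - 2 * \<sigma> * momentum z + pressure z" for z
  have K_line: "((\<lambda>\<tau>. K (\<tau>, r + \<sigma> * (\<tau> - t))) has_integral \<sigma> * (\<Theta> (t, r) - \<Theta> (0, r - \<sigma> * t))) {0..t}" for r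
  proof -
    have "((\<lambda>\<tau>. \<sigma> * ((- momentum (\<tau>, r + \<sigma> * (\<tau> - t)) - \<sigma> * (- pressure (\<tau>, r + \<sigma> * (\<tau> - t))))
          + \<sigma> * (energy (\<tau>, r + \<sigma> * (\<tau> - t)) - \<sigma> * momentum (\<tau>, r + \<sigma> * (\<tau> - t)))))
        has_integral \<sigma> * (\<Theta> (t, r) - \<Theta> (0, r - \<sigma> * t))) {0..t}"
      using has_integral_along_line[OF \<Theta>, of t r \<sigma>] assms(1) by (intro has_integral_mult_right) simp
    moreover have "\<sigma> * ((- momentum z - \<sigma> * (- pressure z)) + \<sigma> * (energy z - \<sigma> * momentum z)) = K z" for z
      using \<sigma> unfolding K_def by algebra
    ultimately show ?thesis by simp
  qed
  define h where "h s r = \<sigma> * \<Theta> (s, \<sigma> * r)" for s r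
  have \<sigma>\<sigma>: "\<sigma> * (\<sigma> * r) = r" for r
    using \<sigma> by (simp add: power2_eq_square flip: mult.assoc)
  have dh: "(h s has_real_derivative energy (s, \<sigma> * r) - \<sigma> * momentum (s, \<sigma> * r)) (at r)"
    if "s \<in> {0..t}" for s r
  proof -
    have "((\<lambda>r. \<Theta> (s, \<sigma> * r)) has_real_derivative (energy (s, \<sigma> * r) - \<sigma> * momentum (s, \<sigma> * r)) * \<sigma>) (at r)"
      by (rule DERIV_chain2[OF has_partials_on_snd[OF \<Theta> that]]) (auto intro!: derivative_eq_intros)
    from DERIV_cmult[OF this, of \<sigma>] show ?thesis
      unfolding h_def[abs_def] by (simp add: \<sigma>\<sigma> mult.commute[of _ \<sigma>])
  qed
  have t: "t \<in> {0..t}" "0 \<in> {0..t}"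
    using assms(1) by auto
  have mono: "h t (\<sigma> * x) \<le> h t (C0 + t)"
    by (rule DERIV_nonneg_imp_nondecreasing[OF x, where f = "h t"])
      (use dh[OF t(1)] energy_minus_momentum_nonneg[OF assms(1) \<sigma>] in blast)
  have edge: "h t (C0 + t) = h 0 C0"
  proof -
    have "K (\<tau>, \<sigma> * (C0 + t) + \<sigma> * (\<tau> - t)) = 0" if "\<tau> \<in> {0..t}" for \<tau>
    proof -
      have eq: "\<sigma> * (C0 + t) + \<sigma> * (\<tau> - t) = \<sigma> * (C0 + \<tau>)"
        by (simp add: algebra_simps)
      have abs: "\<bar>\<sigma> * (C0 + \<tau>)\<bar> = C0 + \<tau>"
        using \<sigma> that C0_pos by (auto simp: power2_eq_1_iff)
      show ?thesis
        using that energy_momentum_pressure[OF _ \<sigma>, of \<tau> "\<sigma> * (C0 + \<tau>)"]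
          characteristic_field_vanishes[OF _ \<sigma>, of \<tau>]
          total_eq_0_outside_light_cone[of \<tau> "\<sigma> * (C0 + \<tau>)"]
        by (simp add: K_def eq abs)
    qed
    from has_integral_eq[OF this K_line[of "\<sigma> * (C0 + t)"]]
    have "\<sigma> * (\<Theta> (t, \<sigma> * (C0 + t)) - \<Theta> (0, \<sigma> * (C0 + t) - \<sigma> * t)) = 0"
      by (simp only: has_integral_0_eq)
    then show ?thesis
      by (simp add: h_def algebra_simps)
  qed
  have initial: "h 0 C0 - h 0 (\<sigma> * x - t) \<le> 2 * S * (C0 - (\<sigma> * x - t))"
  proof -
    have "2 * S * (\<sigma> * x - t) - h 0 (\<sigma> * x - t) \<le> 2 * S * C0 - h 0 C0"
    proof (rule DERIV_nonneg_imp_nondecreasing[where f = "\<lambda>r. 2 * S * r - h 0 r"])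
      fix r
      \<comment> \<open>nonnegativity for \<open>- \<sigma>\<close> says that \<open>- \<sigma>\<close> momentum is at most the energy\<close>
      have "energy (0, \<sigma> * r) - \<sigma> * momentum (0, \<sigma> * r) \<le> 2 * S"
        using energy_minus_momentum_nonneg[of 0 "- \<sigma>" "\<sigma> * r"] S[of "\<sigma> * r"] \<sigma> by simp
      moreover have "((\<lambda>r. 2 * S * r - h 0 r) has_real_derivative
          2 * S - (energy (0, \<sigma> * r) - \<sigma> * momentum (0, \<sigma> * r))) (at r)"
        by (rule DERIV_diff[OF _ dh[OF t(2)]]) (auto intro!: derivative_eq_intros)
      ultimately show "\<exists>d. ((\<lambda>r. 2 * S * r - h 0 r) has_real_derivative d) (at r) \<and> 0 \<le> d"
        by (intro exI conjI) auto
    qed (use x in simp)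
    then show ?thesis by (simp add: algebra_simps)
  qed
  have contK: "continuous_on (strip t) K"
    unfolding K_def energy_def momentum_def pressure_def
    by (intro continuous_intros continuous_on_total[OF assms(1)] continuous_on_fields_strip) auto
  have int: "(LINT v|lborel. (\<Sum>\<alpha>=1..N. f \<alpha> \<tau> (y \<tau>) v * ((rel_energy (m \<alpha>) v - \<sigma> * fst v)\<^sup>2 / rel_energy (m \<alpha>) v)))
      = total (\<lambda>\<alpha> v. (rel_energy (m \<alpha>) v - \<sigma> * fst v)\<^sup>2 / rel_energy (m \<alpha>) v) (\<tau>, y \<tau>)" if "0 \<le> \<tau>" for \<tau>
  proof -
    have "continuous_on UNIV (\<lambda>v. (rel_energy (m \<alpha>) v - \<sigma> * fst v)\<^sup>2 / rel_energy (m \<alpha>) v)"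
      if "\<alpha> \<in> {1..N}" for \<alpha>
    proof -
      have "rel_energy (m \<alpha>) v \<noteq> 0" for v
        using rel_energy_pos[OF mass_pos[OF that], of v] by simp
      then show ?thesis by (intro continuous_intros) blast
    qed
    from integral_sum_eq_total[OF \<open>0 \<le> \<tau>\<close> this] show ?thesis
      by (simp add: mult.commute)
  qed
  have "(LBINT \<tau>:{0..t}. (E2 \<tau> (y \<tau>) - \<sigma> * B \<tau> (y \<tau>))\<^sup>2
           + (LINT v|lborel. (\<Sum>\<alpha>=1..N. f \<alpha> \<tau> (y \<tau>) v * ((rel_energy (m \<alpha>) v - \<sigma> * fst v)\<^sup>2 / rel_energy (m \<alpha>) v))))
      = (LBINT \<tau>:{0..t}. K (\<tau>, x + \<sigma> * (\<tau> - t)))"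
    by (intro set_lebesgue_integral_cong) (auto simp: K_def int energy_momentum_pressure[OF _ \<sigma>] simp flip: y simp del: One_nat_def times_divide_eq_right)
  also have "\<dots> = integral {0..t} (\<lambda>\<tau>. K (\<tau>, x + \<sigma> * (\<tau> - t)))"
    by (intro set_lebesgue_integral_eq_integral_Icc continuous_on_compose2[OF contK])
      (auto intro!: continuous_intros)
  also have "\<dots> = h t (\<sigma> * x) - h 0 (\<sigma> * x - t)"
    using K_line[of x] by (simp add: integral_unique h_def \<sigma>\<sigma> right_diff_distrib)
  also have "\<dots> \<le> 2 * S * (C0 + t - \<sigma> * x)"
    using mono edge initial by (simp add: algebra_simps)
  finally show ?thesis .
qed

section \<open>The two bounds in terms of the data\<close>

lemma energy_initial: "energy (0, x) = initial_energy N e m f0 E20 B0 x"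
proof -
  have "charge_density N e (\<lambda>\<alpha> t. f0 \<alpha>) 0 y = charge_density N e f 0 y" for y
    unfolding charge_density_def
    by (intro Bochner_Integration.integral_cong sum.cong refl) (simp add: initial_values)
  then have "initial_E1 N e f0 x = E1 0 x"
    by (simp add: initial_E1_def E1_formula charge_density_eq)
  moreover have "total (\<lambda>\<alpha>. rel_energy (m \<alpha>)) (0, x)
      = (\<Sum>\<alpha>=1..N. LINT v|lborel. rel_energy (m \<alpha>) v * f0 \<alpha> x v)"
    unfolding total_def moment_def by (intro sum.cong refl) (simp add: initial_values)
  ultimately show ?thesis
    by (simp add: energy_def initial_energy_def initial_values)
qed

lemma energy_initial_outside:
  assumes "C0 \<le> \<bar>x\<bar>"
  shows "energy (0, x) = (E1 0 x)\<^sup>2 / 2"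
  using assms vanish total_eq_0_outside_light_cone[of 0 x]
  by (simp add: energy_def initial_values data_vanish_outside_def)

text \<open>
For \<open>\<bar>x\<bar> \<ge> C0\<close> only \<open>E1\<close> is left, which is constant on either side, so the supremum over \<open>[-C0, C0]\<close> bounds the
initial energy density everywhere.
\<close>
lemma energy_initial_bounded: "energy (0, x) \<le> (SUP r\<in>{-C0..C0}. initial_energy N e m f0 E20 B0 r)"
proof -
  have E1: "has_partials_on 0 (\<lambda>z. E1 (fst z) (snd z)) (\<lambda>z. - current1 z) charge"
    by (rule gauss_ampere_partials) simp
  have flat: "((\<lambda>y. E1 0 y) has_real_derivative 0) (at y)" if "C0 \<le> \<bar>y\<bar>" for y
    using has_partials_on_snd[OF E1, of 0 y] that by (simp add: total_eq_0_outside_light_cone)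
  have "continuous_on (strip 0) energy"
    unfolding energy_def by (intro continuous_intros continuous_on_total continuous_on_fields_strip) auto
  then have "continuous_on {-C0..C0} (\<lambda>r. energy (0, r))"
    by (rule continuous_on_compose2) (auto intro!: continuous_intros)
  then have "bdd_above ((\<lambda>r. energy (0, r)) ` {-C0..C0})"
    by (intro bounded_imp_bdd_above compact_imp_bounded compact_continuous_image) auto
  then have inside: "energy (0, r) \<le> (SUP r\<in>{-C0..C0}. energy (0, r))" if "r \<in> {-C0..C0}" for r
    by (rule cSUP_upper[OF that])
  have "\<exists>r\<in>{-C0..C0}. energy (0, x) = energy (0, r)"
  proof -
    consider "x \<in> {-C0..C0}" | "C0 \<le> x" | "x \<le> - C0"
      by fastforce
    then show ?thesis
    proof cases
      case 2
      have "E1 0 C0 = E1 0 x"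
        by (rule deriv_zero_imp_eq[where g = "E1 0", OF flat 2]) (use C0_pos in auto)
      then show ?thesis
        using 2 C0_pos by (intro bexI[of _ C0]) (auto simp: energy_initial_outside)
    next
      case 3
      have "E1 0 x = E1 0 (- C0)"
        by (rule deriv_zero_imp_eq[where g = "E1 0", OF flat 3]) (use C0_pos in auto)
      then show ?thesis
        using 3 C0_pos by (intro bexI[of _ "- C0"]) (auto simp: energy_initial_outside)
    qed auto
  qed
  then show ?thesis
    using inside by (auto simp: energy_initial)
qed

text \<open>
For \<open>\<bar>x\<bar> \<ge> C0\<close> each of the half-lines \<open>{..x}\<close> and \<open>{x..}\<close> contains either all of the charge, whose sum is
zero, or none of it. So \<open>E1\<close> vanishes there.
\<close>
lemma neutral_energy_initial_outside:
  assumes "neutral N e f0" "C0 \<le> \<bar>x\<bar>"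
  shows "energy (0, x) = 0"
proof -
  have "charge (0, y) = (LINT v|lborel. (\<Sum>\<alpha>=1..N. e \<alpha> * f0 \<alpha> y v))" for y
    unfolding charge_density_eq[OF order_refl, symmetric] charge_density_def
    by (intro Bochner_Integration.integral_cong sum.cong refl) (simp add: initial_values)
  then have neutral: "(LBINT y. charge (0, y)) = 0"
    using assms(1) by (simp add: neutral_def)
  have zero: "charge (0, y) = 0" if "C0 \<le> \<bar>y\<bar>" for y
    using that by (simp add: total_eq_0_outside_light_cone)
  have cases: "(LBINT y:A. charge (0, y)) = 0" if "A \<inter> {-C0<..<C0} = {} \<or> {-C0<..<C0} \<subseteq> A" for A
    using that
  proof
    assume A: "A \<inter> {-C0<..<C0} = {}"
    have "indicator A y *\<^sub>R charge (0, y) = 0" for y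
      using A zero[of y] by (cases "y \<in> {-C0<..<C0}") (auto simp: indicator_def)
    then show ?thesis
      by (simp only: set_lebesgue_integral_def Bochner_Integration.integral_zero)
  next
    assume A: "{-C0<..<C0} \<subseteq> A"
    have "indicator A y *\<^sub>R charge (0, y) = charge (0, y)" for y
      using A zero[of y] by (cases "y \<in> {-C0<..<C0}") (auto simp: indicator_def)
    then show ?thesis
      using neutral by (simp only: set_lebesgue_integral_def)
  qed
  have "(LBINT y:{..x}. charge (0, y)) = 0" "(LBINT y:{x..}. charge (0, y)) = 0"
    by (rule cases; use assms(2) in \<open>auto simp: abs_if split: if_splits\<close>)+
  then show ?thesis
    by (simp add: energy_initial_outside[OF assms(2)] E1_formula)
qed

text \<open>
The two fluxes add up to \<open>2 (\<Psi> (0, x + t) - \<Psi> (0, x - t))\<close>, and the nondecreasing function \<open>\<Psi> (0, \<cdot>)\<close> is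
constant on either side of \<open>[-C0, C0]\<close>.
\<close>
lemma neutral_energy_flux_bound:
  assumes "neutral N e f0" "0 \<le> t"
  shows "(LBINT \<tau>:{0..t}. (E1 \<tau> (x - t + \<tau>))\<^sup>2 + (E2 \<tau> (x - t + \<tau>) - B \<tau> (x - t + \<tau>))\<^sup>2
           + (LINT v|lborel. (\<Sum>\<alpha>=1..N. f \<alpha> \<tau> (x - t + \<tau>) v * (rel_energy (m \<alpha>) v - fst v))))
       + (LBINT \<tau>:{0..t}. (E1 \<tau> (x + t - \<tau>))\<^sup>2 + (E2 \<tau> (x + t - \<tau>) + B \<tau> (x + t - \<tau>))\<^sup>2
           + (LINT v|lborel. (\<Sum>\<alpha>=1..N. f \<alpha> \<tau> (x + t - \<tau>) v * (rel_energy (m \<alpha>) v + fst v))))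
       \<le> 2 * (LBINT r:{-C0..C0}. initial_energy N e m f0 E20 B0 r)"
proof -
  obtain \<Psi> where \<Psi>: "has_partials_on t \<Psi> (\<lambda>z. - momentum z) energy"
    by (rule energy_momentum_potentials[OF assms(2)])
  have t: "t \<in> {0..t}" "0 \<in> {0..t}"
    using assms(2) by auto
  note dPsi = has_partials_on_snd[OF \<Psi> t(2)]
  have nonneg: "0 \<le> energy (0, r)" for r
    using energy_minus_momentum_nonneg[of 0 1 r] energy_minus_momentum_nonneg[of 0 "- 1" r] by simp
  have mono: "\<Psi> (0, a) \<le> \<Psi> (0, b)" if "a \<le> b" for a b
    by (rule DERIV_nonneg_imp_nondecreasing[OF that, where f = "\<lambda>r. \<Psi> (0, r)"])
      (use dPsi nonneg in blast)
  have flat: "((\<lambda>r. \<Psi> (0, r)) has_real_derivative 0) (at r)" if "C0 \<le> \<bar>r\<bar>" for r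
    using dPsi[of r] neutral_energy_initial_outside[OF assms(1) that] by simp
  have upper: "\<Psi> (0, b) \<le> \<Psi> (0, C0)" for b
  proof (cases "b \<le> C0")
    case False
    then have "\<Psi> (0, C0) = \<Psi> (0, b)"
      by (intro deriv_zero_imp_eq[where g = "\<lambda>r. \<Psi> (0, r)"] flat) (use C0_pos in auto)
    then show ?thesis by simp
  qed (rule mono)
  have lower: "\<Psi> (0, - C0) \<le> \<Psi> (0, a)" for a
  proof (cases "- C0 \<le> a")
    case False
    then have "\<Psi> (0, a) = \<Psi> (0, - C0)"
      by (intro deriv_zero_imp_eq[where g = "\<lambda>r. \<Psi> (0, r)"] flat) (use C0_pos in auto)
    then show ?thesis by simp
  qed (rule mono)
  have minus: "(LBINT \<tau>:{0..t}. (E1 \<tau> (x - t + \<tau>))\<^sup>2 + (E2 \<tau> (x - t + \<tau>) - B \<tau> (x - t + \<tau>))\<^sup>2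
           + (LINT v|lborel. (\<Sum>\<alpha>=1..N. f \<alpha> \<tau> (x - t + \<tau>) v * (rel_energy (m \<alpha>) v - fst v))))
      \<le> 2 * (\<Psi> (t, x) - \<Psi> (0, x - t))"
    using energy_flux_through_characteristic[OF \<Psi> t(1), of 1 "\<lambda>\<tau>. x - t + \<tau>" x] by simp
  have plus: "(LBINT \<tau>:{0..t}. (E1 \<tau> (x + t - \<tau>))\<^sup>2 + (E2 \<tau> (x + t - \<tau>) + B \<tau> (x + t - \<tau>))\<^sup>2
           + (LINT v|lborel. (\<Sum>\<alpha>=1..N. f \<alpha> \<tau> (x + t - \<tau>) v * (rel_energy (m \<alpha>) v + fst v))))
      \<le> - 2 * (\<Psi> (t, x) - \<Psi> (0, x + t))"
    using energy_flux_through_characteristic[OF \<Psi> t(1), of "- 1" "\<lambda>\<tau>. x + t - \<tau>" x] by simp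
  show ?thesis
  proof (rule order_trans[OF add_mono[OF minus plus]])
    have "\<Psi> (0, C0) - \<Psi> (0, - C0) = (LBINT r:{-C0..C0}. initial_energy N e m f0 E20 B0 r)"
      using has_partials_on_snd_integral[OF \<Psi> t(2), of "- C0" C0] C0_pos by (simp add: energy_initial)
    note total = this
    show "2 * (\<Psi> (t, x) - \<Psi> (0, x - t)) + - 2 * (\<Psi> (t, x) - \<Psi> (0, x + t))
        \<le> 2 * (LBINT r:{-C0..C0}. initial_energy N e m f0 E20 B0 r)"
      using upper[of "x + t"] lower[of "x - t"] unfolding total[symmetric] by simp
  qed
qed

lemma momentum_flux_bound:
  assumes "0 \<le> t"
  defines "S \<equiv> SUP r\<in>{-C0..C0}. initial_energy N e m f0 E20 B0 r"
  shows "x \<le> C0 + t \<Longrightarrow>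
      (LBINT \<tau>:{0..t}. (E2 \<tau> (x - t + \<tau>) - B \<tau> (x - t + \<tau>))\<^sup>2
         + (LINT v|lborel. (\<Sum>\<alpha>=1..N. f \<alpha> \<tau> (x - t + \<tau>) v
               * ((rel_energy (m \<alpha>) v - fst v)\<^sup>2 / rel_energy (m \<alpha>) v))))
      \<le> 2 * S * (C0 + t - x)"
    and "- C0 - t \<le> x \<Longrightarrow>
      (LBINT \<tau>:{0..t}. (E2 \<tau> (x + t - \<tau>) + B \<tau> (x + t - \<tau>))\<^sup>2
         + (LINT v|lborel. (\<Sum>\<alpha>=1..N. f \<alpha> \<tau> (x + t - \<tau>) v
               * ((rel_energy (m \<alpha>) v + fst v)\<^sup>2 / rel_energy (m \<alpha>) v))))
      \<le> 2 * S * (C0 + t + x)"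
  using momentum_flux_through_characteristic[OF assms(1), of 1 "\<lambda>\<tau>. x - t + \<tau>" x S]
    momentum_flux_through_characteristic[OF assms(1), of "- 1" "\<lambda>\<tau>. x + t - \<tau>" x S]
    energy_initial_bounded[folded S_def]
  by simp_all

end

theorem theorem1p1:
  fixes N :: nat and e m :: "nat \<Rightarrow> real"
    and f0 :: "nat \<Rightarrow> real \<Rightarrow> real \<times> real \<Rightarrow> real" and E20 B0 :: "real \<Rightarrow> real" and C0 :: real
  assumes "1 \<le> N"
    and "\<And>\<alpha>. \<alpha> \<in> {1..N} \<Longrightarrow> 0 < m \<alpha>"
    and "admissible_data N f0 E20 B0"
    and "0 < C0" and "data_vanish_outside N f0 E20 B0 C0"
  shows "(neutral N e f0 \<longrightarrow> (\<exists>C::real. \<forall>f E1 E2 B. global_C1_solution N e m f0 E20 B0 f E1 E2 B \<longrightarrow>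
            (\<forall>t\<ge>0. \<forall>x.
               (LBINT \<tau>:{0..t}. (E1 \<tau> (x - t + \<tau>))\<^sup>2 + (E2 \<tau> (x - t + \<tau>) - B \<tau> (x - t + \<tau>))\<^sup>2
                  + (LINT v|lborel. (\<Sum>\<alpha>=1..N. f \<alpha> \<tau> (x - t + \<tau>) v
                        * (sqrt ((m \<alpha>)\<^sup>2 + (norm v)\<^sup>2) - fst v))))
               + (LBINT \<tau>:{0..t}. (E1 \<tau> (x + t - \<tau>))\<^sup>2 + (E2 \<tau> (x + t - \<tau>) + B \<tau> (x + t - \<tau>))\<^sup>2
                  + (LINT v|lborel. (\<Sum>\<alpha>=1..N. f \<alpha> \<tau> (x + t - \<tau>) v
                        * (sqrt ((m \<alpha>)\<^sup>2 + (norm v)\<^sup>2) + fst v))))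
               \<le> C)))
       \<and> (monocharge N e m \<longrightarrow> (\<exists>C::real. \<forall>f E1 E2 B. global_C1_solution N e m f0 E20 B0 f E1 E2 B \<longrightarrow>
            (\<forall>t\<ge>0.
               (\<forall>x. x < C0 + t \<longrightarrow>
                  (LBINT \<tau>:{0..t}. (E2 \<tau> (x - t + \<tau>) - B \<tau> (x - t + \<tau>))\<^sup>2
                     + (LINT v|lborel. f 1 \<tau> (x - t + \<tau>) v
                           * ((sqrt (1 + (norm v)\<^sup>2) - fst v)\<^sup>2 / sqrt (1 + (norm v)\<^sup>2))))
                  \<le> C * (C0 + t - x)) \<and>
               (\<forall>x. - C0 - t < x \<longrightarrow>
                  (LBINT \<tau>:{0..t}. (E2 \<tau> (x + t - \<tau>) + B \<tau> (x + t - \<tau>))\<^sup>2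
                     + (LINT v|lborel. f 1 \<tau> (x + t - \<tau>) v
                           * ((sqrt (1 + (norm v)\<^sup>2) + fst v)\<^sup>2 / sqrt (1 + (norm v)\<^sup>2))))
                  \<le> C * (C0 + t + x)))))"
proof -
  have VM: "vlasov_maxwell N e m f0 E20 B0 C0 f E1 E2 B"
    if "global_C1_solution N e m f0 E20 B0 f E1 E2 B" for f E1 E2 B
    using assms(2-5) that by unfold_locales
  \<comment> \<open>a bound of the initial energy density that refers to the data only\<close>
  define S where "S = (SUP r\<in>{-C0..C0}. initial_energy N e m f0 E20 B0 r)"
  show ?thesis
  proof (intro conjI impI, goal_cases)
    case 1
    show ?case
      by (intro exI[of _ "2 * (LBINT r:{-C0..C0}. initial_energy N e m f0 E20 B0 r)"] allI impI)
        (rule vlasov_maxwell.neutral_energy_flux_bound[OF VM 1, unfolded rel_energy_def])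
  next
    case 2
    then have mono: "N = 1" "m 1 = 1"
      by (auto simp: monocharge_def)
    show ?case
    proof (intro exI[of _ "2 * S"] allI impI conjI, goal_cases)
      case (1 f E1 E2 B t x)
      with vlasov_maxwell.momentum_flux_bound(1)[OF VM[OF 1(1)] 1(2), of x, folded S_def,
          unfolded rel_energy_def mono atLeastAtMost_singleton, simplified] mono
      show ?case by simp
    next
      case (2 f E1 E2 B t x)
      with vlasov_maxwell.momentum_flux_bound(2)[OF VM[OF 2(1)] 2(2), of x, folded S_def,
          unfolded rel_energy_def mono atLeastAtMost_singleton, simplified] mono
      show ?case by simp
    qed
  qed
qed

end
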